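(* For every infinite set $\Gamma$, the space $c_0(\Gamma)$ admits an equivalent norm $|||\cdot|||$ which is $C^\infty$-smooth and LFC and whose unit ball is dentable. Moreover, this norm is not uniformly Gâteaux in any direction, that is, for every $h\in c_0(\Gamma)\setminus\{0\}$ the norm $|||\cdot|||$ is not uniformly Gâteaux in the direction of $h$.
   Context: All Banach spaces are real. For an infinite set $\Gamma$, $c_0(\Gamma)$ is the Banach space of all functions $x\colon\Gamma\to\mathbb{R}$ such that $\{\gamma\in\Gamma\colon |x(\gamma)|>\varepsilon\}$ is finite for every $\varepsilon>0$, with the supremum norm $\|\cdot\|_\infty$; "equivalent" means equivalent to $\|\cdot\|_\infty$. A norm on a Banach space $X$ is $C^\infty$-smooth if it is infinitely many times Fréchet differentiable on $X\setminus\{0\}$. LFC (locally dependent on finitely many coordinates): if $U\subset X$ is open, a function $f\colon U\to\mathbb{R}$ is LFC at $x\in U$ if there exist an open neighborhood $W\subset U$ of $x$ and a finite set of functionals $\{f_1,\dots,f_n\}\subset X^*$ such that $f(y)=f(x)$ whenever $y\in W$ satisfies $\langle f_i,y\rangle=\langle f_i,x\rangle$ for all $i=1,\dots,n$. The function $f$ is LFC if it is LFC at every point of $U$. A norm on $X$ is LFC if it is LFC on $X\setminus\{0\}$. For a norm $|||\cdot|||$ on $X$, $x,h\in X\setminus\{0\}$ and $t\neq 0$, put $$D(|||\cdot|||,x,h,t)=\frac{|||x+th|||+|||x-th|||-2|||x|||}{t}.$$ The norm $|||\cdot|||$ is uniformly Gâteaux in the direction of $h\in X\setminus\{0\}$ if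 $D(|||\cdot|||,x,h,t)\to 0$ as $t\to 0$, uniformly in $x$ when $x$ ranges over the unit sphere of an equivalent norm on $X$. For a convex set $C\subset X$, $f\in X^*$ and $a>0$, the slice of $C$ defined by $f$ and $a$ is $S(C,f,a)=\{x\in C\colon \langle f,x\rangle>a\}$. A convex set $C$ is dentable if it admits non-empty slices of arbitrarily small diameter in an equivalent norm. *)

theory Defs
  imports "HOL-Analysis.Analysis"
begin

section \<open>The Banach space of functions vanishing at infinity\<close>

text \<open>The index set is the universe of the type \<^typ>\<open>'g\<close>; statements about an infinite index set
  assume that this universe is infinite.\<close>

typedef 'g c0 = "{x :: 'g \<Rightarrow> real. \<forall>\<epsilon>>0. finite {\<gamma>. \<bar>x \<gamma>\<bar> > \<epsilon>}}"
  morphisms coord Abs_c0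
  by (rule exI[of _ "\<lambda>_. 0"]) simp

setup_lifting type_definition_c0

lemma c0_eqI: "(\<And>\<gamma>. coord x \<gamma> = coord y \<gamma>) \<Longrightarrow> x = y"
  by transfer auto

lemma finite_coord: "\<epsilon> > 0 \<Longrightarrow> finite {\<gamma>. \<bar>coord x \<gamma>\<bar> > \<epsilon>}"
  by transfer auto

lemma bdd_above_coord: "bdd_above (range (\<lambda>\<gamma>. \<bar>coord x \<gamma>\<bar>))"
proof -
  let ?F = "{\<gamma>. \<bar>coord x \<gamma>\<bar> > 1}"
  have fin: "finite ?F" by (rule finite_coord) simp
  have "\<bar>coord x \<gamma>\<bar> \<le> 1 + (\<Sum>\<delta>\<in>?F. \<bar>coord x \<delta>\<bar>)" for \<gamma>
  proof (cases "\<gamma> \<in> ?F")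
    case True
    then have "\<bar>coord x \<gamma>\<bar> \<le> (\<Sum>\<delta>\<in>?F. \<bar>coord x \<delta>\<bar>)"
      using fin by (intro member_le_sum) auto
    then show ?thesis by simp
  next
    case False
    moreover have "0 \<le> (\<Sum>\<delta>\<in>?F. \<bar>coord x \<delta>\<bar>)" by (rule sum_nonneg) simp
    ultimately show ?thesis by (simp only: mem_Collect_eq not_less)
  qed
  then show ?thesis by (intro bdd_aboveI[of _ "1 + (\<Sum>\<delta>\<in>?F. \<bar>coord x \<delta>\<bar>)"]) auto
qed

instantiation c0 :: (type) real_vector
begin

lift_definition zero_c0 :: "'a c0" is "\<lambda>_. 0" by simp

lift_definition plus_c0 :: "'a c0 \<Rightarrow> 'a c0 \<Rightarrow> 'a c0" is "\<lambda>x y \<gamma>. x \<gamma> + y \<gamma>"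
proof -
  fix x y :: "'a \<Rightarrow> real" and \<epsilon> :: real
  assume "\<And>\<epsilon>. 0 < \<epsilon> \<Longrightarrow> finite {\<gamma>. \<epsilon> < \<bar>x \<gamma>\<bar>}"
    "\<And>\<epsilon>. 0 < \<epsilon> \<Longrightarrow> finite {\<gamma>. \<epsilon> < \<bar>y \<gamma>\<bar>}" "0 < \<epsilon>"
  then have "finite ({\<gamma>. \<epsilon>/2 < \<bar>x \<gamma>\<bar>} \<union> {\<gamma>. \<epsilon>/2 < \<bar>y \<gamma>\<bar>})"
    using half_gt_zero by blast
  then show "finite {\<gamma>. \<epsilon> < \<bar>x \<gamma> + y \<gamma>\<bar>}"
    by (rule rev_finite_subset) auto
qed

lift_definition uminus_c0 :: "'a c0 \<Rightarrow> 'a c0" is "\<lambda>x \<gamma>. - x \<gamma>" by simp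

lift_definition scaleR_c0 :: "real \<Rightarrow> 'a c0 \<Rightarrow> 'a c0" is "\<lambda>c x \<gamma>. c * x \<gamma>"
proof -
  fix c :: real and x :: "'a \<Rightarrow> real" and \<epsilon> :: real
  assume *: "\<And>\<epsilon>. 0 < \<epsilon> \<Longrightarrow> finite {\<gamma>. \<epsilon> < \<bar>x \<gamma>\<bar>}" "0 < \<epsilon>"
  show "finite {\<gamma>. \<epsilon> < \<bar>c * x \<gamma>\<bar>}"
  proof (cases "c = 0")
    case True
    then show ?thesis using * by simp
  next
    case False
    then have "{\<gamma>. \<epsilon> < \<bar>c * x \<gamma>\<bar>} = {\<gamma>. \<epsilon> / \<bar>c\<bar> < \<bar>x \<gamma>\<bar>}"
      by (auto simp: abs_mult field_simps)
    then show ?thesis using * False by simp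
  qed
qed

definition minus_c0 :: "'a c0 \<Rightarrow> 'a c0 \<Rightarrow> 'a c0" where
  "minus_c0 x y = x + (- y)"

instance
  by standard (unfold minus_c0_def, (transfer, force simp: algebra_simps)+)

end

lemma coord_simps [simp]:
  "coord 0 \<gamma> = 0"
  "coord (x + y) \<gamma> = coord x \<gamma> + coord y \<gamma>"
  "coord (- x) \<gamma> = - coord x \<gamma>"
  "coord (x - y) \<gamma> = coord x \<gamma> - coord y \<gamma>"
  "coord (c *\<^sub>R x) \<gamma> = c * coord x \<gamma>"
  unfolding minus_c0_def by (transfer, simp)+

instantiation c0 :: (type) real_normed_vector
begin

definition norm_c0 :: "'a c0 \<Rightarrow> real" where
  "norm_c0 x = (SUP \<gamma>. \<bar>coord x \<gamma>\<bar>)"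

definition sgn_c0 :: "'a c0 \<Rightarrow> 'a c0" where
  "sgn_c0 x = x /\<^sub>R norm x"

definition dist_c0 :: "'a c0 \<Rightarrow> 'a c0 \<Rightarrow> real" where
  "dist_c0 x y = norm (x - y)"

definition uniformity_c0 :: "('a c0 \<times> 'a c0) filter" where
  "uniformity_c0 = (INF e\<in>{0 <..}. principal {(x, y). dist x y < e})"

definition open_c0 :: "'a c0 set \<Rightarrow> bool" where
  "open_c0 S = (\<forall>x\<in>S. \<forall>\<^sub>F (x', y) in uniformity. x' = x \<longrightarrow> y \<in> S)"

instance
proof
  have up: "\<bar>coord x \<gamma>\<bar> \<le> norm x" for x :: "'a c0" and \<gamma>
    unfolding norm_c0_def by (rule cSUP_upper[OF _ bdd_above_coord]) simp
  have least: "norm x \<le> B" if "\<And>\<gamma>. \<bar>coord x \<gamma>\<bar> \<le> B" for x :: "'a c0" and B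
    unfolding norm_c0_def by (rule cSUP_least) (use that in auto)
  have nonneg: "0 \<le> norm x" for x :: "'a c0"
    using up[of x undefined] by linarith
  fix x y :: "'a c0" and a :: real
  show "dist x y = norm (x - y)" by (rule dist_c0_def)
  show "sgn x = x /\<^sub>R norm x" by (rule sgn_c0_def)
  show "(uniformity :: ('a c0 \<times> 'a c0) filter) = (INF e\<in>{0 <..}. principal {(x, y). dist x y < e})"
    by (rule uniformity_c0_def)
  show "open U = (\<forall>x\<in>U. \<forall>\<^sub>F (x', y) in uniformity. x' = x \<longrightarrow> y \<in> U)" for U :: "'a c0 set"
    by (rule open_c0_def)
  show "norm x = 0 \<longleftrightarrow> x = 0"
  proof
    assume "norm x = 0"
    then have "coord x \<gamma> = 0" for \<gamma> using up[of x \<gamma>] by simp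
    then show "x = 0" by (intro c0_eqI) simp
  next
    assume "x = 0"
    then have "norm x \<le> 0" by (intro least) simp
    then show "norm x = 0" using nonneg[of x] by simp
  qed
  show "norm (x + y) \<le> norm x + norm y"
  proof (rule least)
    show "\<bar>coord (x + y) \<gamma>\<bar> \<le> norm x + norm y" for \<gamma>
      using up[of x \<gamma>] up[of y \<gamma>] by simp
  qed
  have scale: "norm (a *\<^sub>R x) \<le> \<bar>a\<bar> * norm x" for a and x :: "'a c0"
    by (rule least) (simp add: abs_mult mult_left_mono up)
  show "norm (a *\<^sub>R x) = \<bar>a\<bar> * norm x"
  proof (cases "a = 0")
    case True
    then show ?thesis using scale[of a x] nonneg[of "a *\<^sub>R x"] by simp
  next
    case False
    have "norm x \<le> \<bar>inverse a\<bar> * norm (a *\<^sub>R x)"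
      using scale[of "inverse a" "a *\<^sub>R x"] False by simp
    then have "\<bar>a\<bar> * norm x \<le> norm (a *\<^sub>R x)"
      using False by (simp add: field_simps)
    then show ?thesis using scale[of a x] by simp
  qed
qed

end

lemma coord_le_norm: "\<bar>coord x \<gamma>\<bar> \<le> norm x"
  unfolding norm_c0_def by (rule cSUP_upper[OF _ bdd_above_coord]) simp

lemma norm_c0_least: "(\<And>\<gamma>. \<bar>coord x \<gamma>\<bar> \<le> B) \<Longrightarrow> norm x \<le> B"
  unfolding norm_c0_def by (rule cSUP_least) auto

instance c0 :: (type) banach
proof
  fix X :: "nat \<Rightarrow> 'a c0"
  assume X: "Cauchy X"
  have lin: "\<bar>coord (X m) \<gamma> - coord (X n) \<gamma>\<bar> \<le> norm (X m - X n)" for m n \<gamma>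
    using coord_le_norm[of "X m - X n" \<gamma>] by simp
  have "Cauchy (\<lambda>n. coord (X n) \<gamma>)" for \<gamma>
    unfolding Cauchy_iff
  proof (intro allI impI)
    fix e :: real assume "e > 0"
    then obtain M where "\<forall>m\<ge>M. \<forall>n\<ge>M. norm (X m - X n) < e"
      using X unfolding Cauchy_iff by blast
    then show "\<exists>M. \<forall>m\<ge>M. \<forall>n\<ge>M. norm (coord (X m) \<gamma> - coord (X n) \<gamma>) < e"
      using lin[of _ \<gamma>] by (metis le_less_trans real_norm_def)
  qed
  then have "\<exists>l. (\<lambda>n. coord (X n) \<gamma>) \<longlonglongrightarrow> l" for \<gamma>
    using Cauchy_convergent_iff convergent_def by blast
  then obtain l where l: "\<And>\<gamma>. (\<lambda>n. coord (X n) \<gamma>) \<longlonglongrightarrow> l \<gamma>" by metis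
  have unif: "\<exists>M. \<forall>n\<ge>M. \<forall>\<gamma>. \<bar>coord (X n) \<gamma> - l \<gamma>\<bar> \<le> e" if "e > 0" for e
  proof -
    obtain M where M: "\<And>m n. m \<ge> M \<Longrightarrow> n \<ge> M \<Longrightarrow> norm (X m - X n) < e"
      using X \<open>e > 0\<close> unfolding Cauchy_iff by blast
    have "\<bar>coord (X n) \<gamma> - l \<gamma>\<bar> \<le> e" if n: "n \<ge> M" for n \<gamma>
    proof (rule tendsto_upperbound)
      show "(\<lambda>m. \<bar>coord (X n) \<gamma> - coord (X m) \<gamma>\<bar>) \<longlonglongrightarrow> \<bar>coord (X n) \<gamma> - l \<gamma>\<bar>"
        by (intro tendsto_intros l)
      show "\<forall>\<^sub>F m in sequentially. \<bar>coord (X n) \<gamma> - coord (X m) \<gamma>\<bar> \<le> e"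
        unfolding eventually_sequentially
        using M[OF n] lin[of n \<gamma>] by (meson less_le_trans less_imp_le order_trans)
    qed simp
    then show ?thesis by blast
  qed
  have "finite {\<gamma>. \<bar>l \<gamma>\<bar> > e}" if "e > 0" for e
  proof -
    obtain M where M: "\<And>\<gamma>. \<bar>coord (X M) \<gamma> - l \<gamma>\<bar> \<le> e / 2"
      using unif[of "e / 2"] \<open>e > 0\<close> by auto
    have "{\<gamma>. \<bar>l \<gamma>\<bar> > e} \<subseteq> {\<gamma>. \<bar>coord (X M) \<gamma>\<bar> > e / 2}"
    proof safe
      fix \<gamma> assume "e < \<bar>l \<gamma>\<bar>"
      then show "e / 2 < \<bar>coord (X M) \<gamma>\<bar>" using M[of \<gamma>] by linarith
    qed
    then show ?thesis using finite_coord[of "e / 2" "X M"] \<open>e > 0\<close> finite_subset by auto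
  qed
  then have L: "coord (Abs_c0 l) = l" by (intro Abs_c0_inverse) simp
  have "X \<longlonglongrightarrow> Abs_c0 l"
  proof (rule LIMSEQ_I)
    fix e :: real assume "e > 0"
    then obtain M where M: "\<forall>n\<ge>M. \<forall>\<gamma>. \<bar>coord (X n) \<gamma> - l \<gamma>\<bar> \<le> e / 2"
      using unif[of "e / 2"] by auto
    have "norm (X n - Abs_c0 l) < e" if "n \<ge> M" for n
    proof -
      have "norm (X n - Abs_c0 l) \<le> e / 2"
        by (rule norm_c0_least) (use M that L in simp)
      then show ?thesis using \<open>e > 0\<close> by linarith
    qed
    then show "\<exists>no. \<forall>n\<ge>no. norm (X n - Abs_c0 l) < e" by blast
  qed
  then show "convergent X" by (rule convergentI)
qed


section \<open>Equivalent norms\<close>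

definition is_norm :: "('a::real_vector \<Rightarrow> real) \<Rightarrow> bool" where
  "is_norm N \<longleftrightarrow>
     (\<forall>x. N x = 0 \<longleftrightarrow> x = 0) \<and>
     (\<forall>c x. N (c *\<^sub>R x) = \<bar>c\<bar> * N x) \<and>
     (\<forall>x y. N (x + y) \<le> N x + N y)"

definition equivalent_norm :: "('a::real_normed_vector \<Rightarrow> real) \<Rightarrow> bool" where
  "equivalent_norm N \<longleftrightarrow>
     is_norm N \<and> (\<exists>a>0. \<exists>b>0. \<forall>x. a * norm x \<le> N x \<and> N x \<le> b * norm x)"


section \<open>Infinite Frechet differentiability\<close>

text \<open>The iterated spaces of operators in which the successive Frechet derivatives live have
  pairwise different types. They are therefore replaced by the isometric spaces of bounded
  \<open>n\<close>-linear forms; such a form is a function on lists, of which only the values on lists of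
  length \<open>n\<close> matter. The head of the list is the argument in which the last derivative is taken.\<close>

definition bounded_multilinear :: "nat \<Rightarrow> ('a::real_normed_vector list \<Rightarrow> real) \<Rightarrow> bool" where
  "bounded_multilinear n T \<longleftrightarrow>
     (\<forall>vs i. length vs = n \<and> i < n \<longrightarrow> linear (\<lambda>v. T (vs[i := v]))) \<and>
     (\<exists>K. \<forall>vs. length vs = n \<longrightarrow> \<bar>T vs\<bar> \<le> K * prod_list (map norm vs))"

text \<open>Frechet differentiability at \<open>x\<close>, with respect to the operator norm, of a map \<open>F\<close> into the
  bounded \<open>n\<close>-linear forms; the derivative \<open>T\<close> is a bounded \<open>(n+1)\<close>-linear form.\<close>

definition has_multilinear_derivative ::
  "nat \<Rightarrow> ('a::real_normed_vector \<Rightarrow> 'a list \<Rightarrow> real) \<Rightarrow> ('a list \<Rightarrow> real) \<Rightarrow> 'a \<Rightarrow> bool" where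
  "has_multilinear_derivative n F T x \<longleftrightarrow>
     bounded_multilinear (Suc n) T \<and>
     (\<forall>\<epsilon>>0. \<exists>\<delta>>0. \<forall>h. norm h < \<delta> \<longrightarrow>
        (\<forall>vs. length vs = n \<longrightarrow>
           \<bar>F (x + h) vs - F x vs - T (h # vs)\<bar> \<le> \<epsilon> * norm h * prod_list (map norm vs)))"

text \<open>Meant for open sets \<open>S\<close>; \<open>D n x\<close> is the \<open>n\<close>-th Frechet derivative of \<open>f\<close> at \<open>x\<close>.\<close>

definition infinitely_differentiable_on ::
  "'a::real_normed_vector set \<Rightarrow> ('a \<Rightarrow> real) \<Rightarrow> bool" where
  "infinitely_differentiable_on S f \<longleftrightarrow>
     (\<exists>D :: nat \<Rightarrow> 'a \<Rightarrow> 'a list \<Rightarrow> real.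
        (\<forall>x\<in>S. D 0 x [] = f x) \<and>
        (\<forall>n. \<forall>x\<in>S. has_multilinear_derivative n (D n) (D (Suc n) x) x))"

text \<open>For \<open>n = 0\<close> and \<open>n = 1\<close> this is the library's Frechet derivative of maps into the reals
  and into the dual space, respectively.\<close>

lemma has_multilinear_derivative_0_iff:
  "has_multilinear_derivative 0 F T x \<longleftrightarrow>
     ((\<lambda>y. F y []) has_derivative (\<lambda>h. T [h])) (at x)"
proof -
  have "bounded_multilinear (Suc 0) T \<longleftrightarrow> bounded_linear (\<lambda>h. T [h])"
  proof -
    have "(\<forall>vs i. length vs = Suc 0 \<and> i < Suc 0 \<longrightarrow> linear (\<lambda>v. T (vs[i := v])))
        \<longleftrightarrow> linear (\<lambda>v. T [v])"
      by (auto simp: length_Suc_conv)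
    moreover have "(\<forall>vs. length vs = Suc 0 \<longrightarrow> \<bar>T vs\<bar> \<le> K * prod_list (map norm vs))
        \<longleftrightarrow> (\<forall>h. norm (T [h]) \<le> norm h * K)" for K
      by (fastforce simp: length_Suc_conv mult.commute)
    ultimately show ?thesis
      unfolding bounded_multilinear_def bounded_linear_def bounded_linear_axioms_def
      by simp
  qed
  then show ?thesis
    unfolding has_multilinear_derivative_def has_derivative_at_alt
    by (auto simp: all_conj_distrib dest: spec[of _ "x + _"])
      (metis add_diff_cancel_left' diff_add_cancel add.commute)+
qed

lemma has_multilinear_derivative_1_iff:
  fixes F F' :: "'a::real_normed_vector \<Rightarrow> 'a \<Rightarrow>\<^sub>L real"
  shows "has_multilinear_derivative 1
       (\<lambda>y vs. blinfun_apply (F y) (vs ! 0)) (\<lambda>vs. blinfun_apply (F' (vs ! 0)) (vs ! 1)) x \<longleftrightarrow>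
     (F has_derivative F') (at x)"
proof -
  let ?T = "\<lambda>vs. blinfun_apply (F' (vs ! 0)) (vs ! 1)"
  have len1: "(\<forall>vs. length vs = Suc 0 \<longrightarrow> P vs) \<longleftrightarrow> (\<forall>v. P [v])" for P :: "'a list \<Rightarrow> bool"
    by (metis length_0_conv length_Suc_conv)
  have len2: "(\<forall>vs. length vs = Suc (Suc 0) \<longrightarrow> P vs) \<longleftrightarrow> (\<forall>u v. P [u, v])" for P :: "'a list \<Rightarrow> bool"
    by (metis length_0_conv length_Suc_conv)
  have norm_le: "(\<forall>v. \<bar>blinfun_apply A v\<bar> \<le> K * norm v) \<longleftrightarrow> norm A \<le> K"
    if "K \<ge> 0" for A :: "'a \<Rightarrow>\<^sub>L real" and K
  proof
    assume "\<forall>v. \<bar>blinfun_apply A v\<bar> \<le> K * norm v"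
    then show "norm A \<le> K" using that by (intro norm_blinfun_bound) auto
  next
    assume "norm A \<le> K"
    then show "\<forall>v. \<bar>blinfun_apply A v\<bar> \<le> K * norm v"
      using norm_blinfun[of A] by (metis mult_right_mono norm_ge_zero order_trans real_norm_def)
  qed
  have lin: "(\<forall>v. linear (\<lambda>u. blinfun_apply (F' u) v)) \<longleftrightarrow> linear F'"
    unfolding linear_iff by (auto simp: blinfun.bilinear_simps intro!: blinfun_eqI)
  have bdd: "(\<exists>K. \<forall>u v. \<bar>blinfun_apply (F' u) v\<bar> \<le> K * (norm u * norm v))
      \<longleftrightarrow> (\<exists>K. \<forall>u. norm (F' u) \<le> norm u * K)" (is "?L \<longleftrightarrow> ?R")
  proof
    assume ?L
    then obtain K where K: "\<And>u v. \<bar>blinfun_apply (F' u) v\<bar> \<le> K * (norm u * norm v)" by blast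
    have "norm (F' u) \<le> norm u * \<bar>K\<bar>" for u
    proof -
      have "\<bar>blinfun_apply (F' u) v\<bar> \<le> (norm u * \<bar>K\<bar>) * norm v" for v
      proof -
        have "K * (norm u * norm v) \<le> \<bar>K\<bar> * (norm u * norm v)"
          by (intro mult_right_mono) auto
        then show ?thesis using K[of u v] by (simp add: mult_ac)
      qed
      then show ?thesis using norm_le[of "norm u * \<bar>K\<bar>" "F' u"] by simp
    qed
    then show ?R by blast
  next
    assume ?R
    then obtain K where K: "\<And>u. norm (F' u) \<le> norm u * K" by blast
    have "\<bar>blinfun_apply (F' u) v\<bar> \<le> K * (norm u * norm v)" for u v
      using norm_blinfun[of "F' u" v] mult_right_mono[OF K[of u] norm_ge_zero[of v]]
      by (simp add: mult_ac)
    then show ?L by blast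
  qed
  have slots: "(\<forall>vs i. length vs = Suc (Suc 0) \<and> i < Suc (Suc 0) \<longrightarrow> linear (\<lambda>v. ?T (vs[i := v])))
      \<longleftrightarrow> (\<forall>v. linear (\<lambda>u. blinfun_apply (F' u) v))"
  proof -
    have "(\<forall>vs. length vs = Suc (Suc 0) \<longrightarrow> (\<forall>i<Suc (Suc 0). linear (\<lambda>v. ?T (vs[i := v]))))
      \<longleftrightarrow> (\<forall>v. linear (\<lambda>u. blinfun_apply (F' u) v))"
      unfolding len2 by (auto simp: less_Suc_eq linear_iff blinfun.bilinear_simps)
    then show ?thesis by blast
  qed
  have "bounded_multilinear (Suc (Suc 0)) ?T \<longleftrightarrow> bounded_linear F'"
    unfolding bounded_multilinear_def bounded_linear_def bounded_linear_axioms_def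
      slots len2 lin[symmetric] bdd[symmetric] by simp
  moreover have "(\<forall>\<epsilon>>0. \<exists>\<delta>>0. \<forall>h. norm h < \<delta> \<longrightarrow>
        (\<forall>vs. length vs = Suc 0 \<longrightarrow>
           \<bar>blinfun_apply (F (x + h)) (vs ! 0) - blinfun_apply (F x) (vs ! 0) - ?T (h # vs)\<bar>
             \<le> \<epsilon> * norm h * prod_list (map norm vs))) \<longleftrightarrow>
     (\<forall>\<epsilon>>0. \<exists>\<delta>>0. \<forall>y. norm (y - x) < \<delta> \<longrightarrow>
        norm (F y - F x - F' (y - x)) \<le> \<epsilon> * norm (y - x))"
  proof -
    have "(\<forall>vs. length vs = Suc 0 \<longrightarrow>
           \<bar>blinfun_apply (F (x + h)) (vs ! 0) - blinfun_apply (F x) (vs ! 0) - ?T (h # vs)\<bar>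
             \<le> \<epsilon> * norm h * prod_list (map norm vs))
       \<longleftrightarrow> norm (F (x + h) - F x - F' h) \<le> \<epsilon> * norm h" if "\<epsilon> > 0" for \<epsilon> h
      unfolding len1
      using norm_le[of "\<epsilon> * norm h" "F (x + h) - F x - F' h"] that
      by (simp add: blinfun.bilinear_simps)
    then have "?thesis \<longleftrightarrow> (\<forall>\<epsilon>>0. \<exists>\<delta>>0. \<forall>h. norm h < \<delta> \<longrightarrow>
          norm (F (x + h) - F x - F' h) \<le> \<epsilon> * norm h) =
      (\<forall>\<epsilon>>0. \<exists>\<delta>>0. \<forall>y. norm (y - x) < \<delta> \<longrightarrow>
          norm (F y - F x - F' (y - x)) \<le> \<epsilon> * norm (y - x))"
      by (simp cong: conj_cong imp_cong)
    moreover have "(\<forall>h. norm h < \<delta> \<longrightarrow> norm (F (x + h) - F x - F' h) \<le> \<epsilon> * norm h) \<longleftrightarrow>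
        (\<forall>y. norm (y - x) < \<delta> \<longrightarrow> norm (F y - F x - F' (y - x)) \<le> \<epsilon> * norm (y - x))" for \<delta> \<epsilon>
      by (metis add_diff_cancel_left' diff_add_cancel add.commute)
    ultimately show ?thesis by simp
  qed
  ultimately show ?thesis
    unfolding has_multilinear_derivative_def has_derivative_at_alt One_nat_def by simp
qed

lemma infinitely_differentiable_on_imp_differentiable:
  assumes "infinitely_differentiable_on S f" "open S" "x \<in> S"
  shows "f differentiable (at x)"
proof -
  obtain D :: "nat \<Rightarrow> 'a \<Rightarrow> 'a list \<Rightarrow> real" where
    D0: "\<And>y. y \<in> S \<Longrightarrow> D 0 y [] = f y" and
    D1: "has_multilinear_derivative 0 (D 0) (D (Suc 0) x) x"
    using assms unfolding infinitely_differentiable_on_def by blast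
  have "(f has_derivative (\<lambda>h. D (Suc 0) x [h])) (at x)"
    by (rule has_derivative_transform_within_open
        [OF D1[unfolded has_multilinear_derivative_0_iff] assms(2,3) D0])
  then show ?thesis by (rule differentiableI)
qed

definition C_infinity_smooth_norm :: "('a::real_normed_vector \<Rightarrow> real) \<Rightarrow> bool" where
  "C_infinity_smooth_norm N \<longleftrightarrow> infinitely_differentiable_on (- {0}) N"


section \<open>Local dependence on finitely many coordinates\<close>

definition LFC_at :: "'a::real_normed_vector set \<Rightarrow> ('a \<Rightarrow> real) \<Rightarrow> 'a \<Rightarrow> bool" where
  "LFC_at U f x \<longleftrightarrow>
     (\<exists>W (\<Phi> :: ('a \<Rightarrow>\<^sub>L real) set). open W \<and> x \<in> W \<and> W \<subseteq> U \<and> finite \<Phi> \<and>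
        (\<forall>y\<in>W. (\<forall>\<phi>\<in>\<Phi>. blinfun_apply \<phi> y = blinfun_apply \<phi> x) \<longrightarrow> f y = f x))"

definition LFC_on :: "'a::real_normed_vector set \<Rightarrow> ('a \<Rightarrow> real) \<Rightarrow> bool" where
  "LFC_on U f \<longleftrightarrow> (\<forall>x\<in>U. LFC_at U f x)"

definition LFC_norm :: "('a::real_normed_vector \<Rightarrow> real) \<Rightarrow> bool" where
  "LFC_norm N \<longleftrightarrow> LFC_on (- {0}) N"


section \<open>Uniformly Gateaux norms\<close>

definition second_difference ::
  "('a::real_vector \<Rightarrow> real) \<Rightarrow> 'a \<Rightarrow> 'a \<Rightarrow> real \<Rightarrow> real" where
  "second_difference N x h t = (N (x + t *\<^sub>R h) + N (x - t *\<^sub>R h) - 2 * N x) / t"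

definition uniformly_Gateaux_in_direction ::
  "('a::real_normed_vector \<Rightarrow> real) \<Rightarrow> 'a \<Rightarrow> bool" where
  "uniformly_Gateaux_in_direction N h \<longleftrightarrow>
     (\<exists>M. equivalent_norm M \<and>
        uniform_limit {x. M x = 1} (\<lambda>t x. second_difference N x h t) (\<lambda>_. 0) (at 0))"


section \<open>Dentability\<close>

definition slice :: "'a::real_normed_vector set \<Rightarrow> ('a \<Rightarrow>\<^sub>L real) \<Rightarrow> real \<Rightarrow> 'a set" where
  "slice C f a = {x \<in> C. blinfun_apply f x > a}"

text \<open>The inner quantifier says that the \<open>M\<close>-diameter of the slice is at most \<open>\<epsilon>\<close>.\<close>

definition dentable :: "'a::real_normed_vector set \<Rightarrow> bool" where
  "dentable C \<longleftrightarrow> convex C \<and>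
     (\<exists>M. equivalent_norm M \<and>
        (\<forall>\<epsilon>>0. \<exists>f a. a > 0 \<and> slice C f a \<noteq> {} \<and>
           (\<forall>x\<in>slice C f a. \<forall>y\<in>slice C f a. M (x - y) \<le> \<epsilon>)))"

end

theory Submission
  imports Defs
begin

text \<open>
  The unit ball is cut out of \<open>c\<^sub>0(\<Gamma>)\<close> by smooth penalties. A set \<open>I\<close> of pairs \<open>(g, c)\<close> of a
  functional and a threshold defines the convex body of all \<open>x\<close> for which the sum of
  \<open>\<phi>(g x - c)\<close> over \<open>I\<close> is at most \<open>1\<close>. Here \<open>\<phi>(s) = exp (s - 1/s)\<close> for \<open>s > 0\<close> and \<open>\<phi>(s) = 0\<close>
  otherwise, a convex function of class \<open>C\<^sup>\<infinity>\<close> with \<open>\<phi>(1) = 1\<close>. The norm is the Minkowski gauge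
  \<open>N\<close> of that body.

  If near every point of the body only finitely many pairs are active, in the sense that
  \<open>g x > c\<close>, then near every \<open>x \<noteq> 0\<close> the number \<open>N x\<close> is the unique solution \<open>t\<close> of a finite
  equation in which the terms \<open>\<phi>(g x / t - c)\<close> add up to \<open>1\<close> (\<open>local_barrier_equation\<close>). The
  finitely many functionals \<open>g\<close> thus determine \<open>N\<close> locally, which is LFC. Implicit
  differentiation writes the derivative of \<open>N\<close> as a combination of these \<open>g\<close> whose coefficients
  are again built from \<open>N\<close>, the \<open>g\<close> and derivatives of \<open>\<phi>\<close> by sums, products, inverses and
  composition. So all functions built in this way have derivatives of the same kind, and \<open>N\<close> is
  infinitely differentiable
  (\<open>infinitely_differentiable_on_if_derivative_in_generated_algebra\<close>).

  For dentability the ball needs sharp tips. Take weights \<open>k \<gamma> \<ge> 8\<close>, unbounded on \<open>\<Gamma>\<close>, and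
  consider the constraints
  \<open>\<bar>x \<gamma>\<bar> \<le> 1\<close> and \<open>(1 - 2 / k \<gamma>) \<bar>x \<gamma>\<bar> + \<bar>x \<delta>\<bar> / 2 \<le> 1\<close> for \<open>\<delta> \<noteq> \<gamma>\<close>, each of them smoothed at
  relative scale \<open>1 / k \<gamma>\<close>. Near the unit vector at \<open>\<gamma>\<close> the ball is a cone of fixed opening, blunted
  at scale \<open>1 / k \<gamma>\<close>. Hence the slice \<open>x \<gamma> > 1 - 2 / k \<gamma>\<close> has diameter at most \<open>16 / k \<gamma>\<close>
  (\<open>slice_diameter\<close>). In any direction \<open>h\<close>, choose \<open>\<delta>\<close> with \<open>h \<delta> \<noteq> 0\<close> and \<open>\<gamma> \<noteq> \<delta>\<close>. At the tip \<open>\<gamma>\<close> the second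
  difference quotient of \<open>N\<close> at a given \<open>t > 0\<close> is at least \<open>\<bar>h \<delta>\<bar>\<close> up to an error of order
  \<open>1 / (k \<gamma> t)\<close> (\<open>second_difference_lower_bound\<close>), which tends to \<open>0\<close> as \<open>k \<gamma>\<close> grows: the
  quotients cannot tend to \<open>0\<close> uniformly.

  The factor \<open>1 - 2 / k \<gamma>\<close> instead of \<open>1\<close> is what saves local finiteness: at a point with
  \<open>\<bar>x \<gamma>\<bar> = 1\<close> the constraint for \<open>(\<gamma>, \<delta>)\<close> is inactive as soon as \<open>x \<delta>\<close> is small compared with
  \<open>1 / k \<gamma>\<close>, that is, for all but finitely many \<open>\<delta>\<close>.
\<close>

section \<open>A convex flat function\<close>

text \<open>The \<open>m\<close>-th derivative of \<open>exp (s - 1 / s)\<close> is this polynomial in \<open>1 / s\<close> times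
  \<open>exp (s - 1 / s)\<close>.\<close>

primrec flat_poly :: "nat \<Rightarrow> real poly" where
  "flat_poly 0 = 1"
| "flat_poly (Suc m) = [:1, 0, 1:] * flat_poly m - [:0, 0, 1:] * pderiv (flat_poly m)"

text \<open>The summand \<open>s\<close> in the exponent makes the function convex on the whole half-line;
  \<open>exp (- 1 / s)\<close> alone is convex only for \<open>s \<le> 1 / 2\<close>.\<close>

definition flat_exp :: "nat \<Rightarrow> real \<Rightarrow> real" where
  "flat_exp m s = (if s > 0 then poly (flat_poly m) (1 / s) * exp (s - 1 / s) else 0)"

lemma poly_times_exp_uminus_tendsto_0:
  fixes p :: "real poly"
  shows "((\<lambda>u. poly p u * exp (- u)) \<longlongrightarrow> 0) at_top"
proof -
  have "((\<lambda>u. \<Sum>i\<le>degree p. coeff p i * (u ^ i / exp u)) \<longlongrightarrow> (\<Sum>i\<le>degree p. coeff p i * 0)) at_top"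
    by (intro tendsto_intros tendsto_power_div_exp_0)
  then show ?thesis
    by (simp add: poly_altdef exp_minus divide_inverse sum_distrib_right mult.assoc)
qed

text \<open>Flatness at the origin, the only point where differentiability is not immediate.\<close>

lemma flat_exp_over_id_tendsto_0: "((\<lambda>s. flat_exp m s / s) \<longlongrightarrow> 0) (at 0)"
proof (rule filterlim_split_at_real)
  show "((\<lambda>s. flat_exp m s / s) \<longlongrightarrow> 0) (at_left 0)"
  proof (rule tendsto_eventually)
    show "\<forall>\<^sub>F s in at_left 0. flat_exp m s / s = 0"
      unfolding eventually_at_filter by (simp add: flat_exp_def)
  qed
next
  have "((\<lambda>s. poly (pCons 0 (flat_poly m)) (inverse s) * exp (- inverse s)) \<longlongrightarrow> 0) (at_right (0::real))"
    by (rule filterlim_compose[OF poly_times_exp_uminus_tendsto_0 filterlim_inverse_at_top_right])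
  moreover have "((\<lambda>s. exp s) \<longlongrightarrow> exp (0::real)) (at_right 0)"
    by (intro tendsto_intros)
  ultimately have "((\<lambda>s. poly (pCons 0 (flat_poly m)) (inverse s) * exp (- inverse s) * exp s) \<longlongrightarrow> 0 * exp 0)
      (at_right (0::real))"
    by (rule tendsto_mult)
  then have lim: "((\<lambda>s. poly (pCons 0 (flat_poly m)) (inverse s) * exp (- inverse s) * exp s) \<longlongrightarrow> 0)
      (at_right (0::real))"
    by simp
  show "((\<lambda>s. flat_exp m s / s) \<longlongrightarrow> 0) (at_right 0)"
  proof (rule Lim_transform_eventually[OF lim])
    show "\<forall>\<^sub>F s in at_right 0.
        poly (pCons 0 (flat_poly m)) (inverse s) * exp (- inverse s) * exp s = flat_exp m s / s"
      unfolding eventually_at_filter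
    proof (intro always_eventually allI impI)
      fix s :: real assume "s \<noteq> 0" and s: "s \<in> {0<..}"
      have "exp (s - inverse s) = exp (- inverse s) * exp s"
        by (simp flip: exp_add)
      then show "poly (pCons 0 (flat_poly m)) (inverse s) * exp (- inverse s) * exp s = flat_exp m s / s"
        using s by (simp add: flat_exp_def divide_inverse)
    qed
  qed
qed

lemma flat_exp_has_field_derivative:
  "(flat_exp m has_field_derivative flat_exp (Suc m) s) (at s)"
proof -
  consider "s < 0" | "s = 0" | "s > 0" by linarith
  then show ?thesis
  proof cases
    case 1
    have "((\<lambda>_. 0) has_field_derivative flat_exp (Suc m) s) (at s)"
      using 1 by (simp add: flat_exp_def)
    then show ?thesis
      by (rule has_field_derivative_transform_within_open[of _ _ _ "{..<0}"])
        (use 1 in \<open>auto simp: flat_exp_def\<close>)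
  next
    case 2
    then show ?thesis
      using flat_exp_over_id_tendsto_0[of m]
      by (simp add: has_field_derivative_iff flat_exp_def)
  next
    case 3
    have "((\<lambda>s. poly (flat_poly m) (1 / s) * exp (s - 1 / s))
        has_field_derivative flat_exp (Suc m) s) (at s)"
      using 3
      by (auto intro!: derivative_eq_intros DERIV_chain2[OF poly_DERIV]
          simp: flat_exp_def field_simps power2_eq_square)
    then show ?thesis
      by (rule has_field_derivative_transform_within_open[of _ _ _ "{0<..}"])
        (use 3 in \<open>auto simp: flat_exp_def\<close>)
  qed
qed

lemma flat_exp_nonpos [simp]: "s \<le> 0 \<Longrightarrow> flat_exp m s = 0"
  by (simp add: flat_exp_def)

lemma flat_exp_0_nonneg: "0 \<le> flat_exp 0 s"
  by (simp add: flat_exp_def)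

lemma flat_exp_1_pos: "s > 0 \<Longrightarrow> 0 < flat_exp (Suc 0) s"
  by (simp add: flat_exp_def pos_add_strict)

lemma flat_exp_0_strict_mono:
  assumes "0 < t" "s < t"
  shows "flat_exp 0 s < flat_exp 0 t"
proof (cases "s > 0")
  case True
  then have "1 / t < 1 / s" using assms by (simp add: frac_less2)
  then show ?thesis using True assms by (simp add: flat_exp_def)
qed (use assms in \<open>simp add: flat_exp_def\<close>)

lemma flat_exp_0_le_1_imp: "flat_exp 0 s \<le> 1 \<Longrightarrow> s \<le> 1"
  using flat_exp_0_strict_mono[of s 1] by (auto simp: not_le flat_exp_def[of 0 1] intro: leI dest: flat_exp_0_strict_mono[of _ 1])

text \<open>The second derivative has the sign of \<open>(u\<^sup>2 - u)\<^sup>2 + u\<^sup>2 + 1\<close> at \<open>u = 1 / s\<close>.\<close>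

lemma convex_on_flat_exp: "convex_on UNIV (flat_exp 0)"
proof (rule f''_ge0_imp_convex[where f' = "flat_exp 1" and f'' = "flat_exp 2"])
  show "flat_exp 2 s \<ge> 0" for s
  proof -
    have "poly (flat_poly 2) u = (u\<^sup>2 - u)\<^sup>2 + u\<^sup>2 + 1" for u
      by (simp add: numeral_2_eq_2 pderiv_pCons algebra_simps power2_eq_square one_pCons)
    then show ?thesis by (simp add: flat_exp_def add_nonneg_nonneg)
  qed
qed (use flat_exp_has_field_derivative[of 0] flat_exp_has_field_derivative[of 1] in
    \<open>simp_all add: numeral_2_eq_2\<close>)

section \<open>Infinite differentiability of functions of finitely many functionals\<close>

lemma linear_prod_list_slot:
  fixes \<phi>s :: "('a::real_normed_vector \<Rightarrow>\<^sub>L real) list"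
  assumes "length \<phi>s = length vs" "i < length vs"
  shows "linear (\<lambda>v. prod_list (map2 blinfun_apply \<phi>s (vs[i := v])))"
  using assms
proof (induction \<phi>s vs arbitrary: i rule: list_induct2)
  case (Cons \<phi> \<phi>s v vs)
  show ?case
  proof (cases i)
    case 0
    then show ?thesis by (simp add: linear_iff blinfun.bilinear_simps algebra_simps)
  next
    case (Suc j)
    then have "linear (\<lambda>v. prod_list (map2 blinfun_apply \<phi>s (vs[j := v])))"
      using Cons by simp
    then show ?thesis by (simp add: Suc linear_iff algebra_simps)
  qed
qed simp

lemma abs_prod_list_map2_le:
  fixes \<phi>s :: "('a::real_normed_vector \<Rightarrow>\<^sub>L real) list"
  assumes "length \<phi>s = length vs"
  shows "\<bar>prod_list (map2 blinfun_apply \<phi>s vs)\<bar> \<le> prod_list (map norm \<phi>s) * prod_list (map norm vs)"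
  using assms
proof (induction \<phi>s vs rule: list_induct2)
  case (Cons \<phi> \<phi>s v vs)
  have "\<bar>blinfun_apply \<phi> v * prod_list (map2 blinfun_apply \<phi>s vs)\<bar>
      \<le> (norm \<phi> * norm v) * (prod_list (map norm \<phi>s) * prod_list (map norm vs))"
    unfolding abs_mult using norm_blinfun[of \<phi> v] Cons.IH by (intro mult_mono) auto
  then show ?case by (simp add: mult_ac)
qed simp

lemma prod_list_map_norm_nonneg: "0 \<le> prod_list (map norm vs)"
  by (induction vs) auto

lemma bounded_multilinear_sum_tensors:
  fixes L :: "('a::real_normed_vector \<Rightarrow>\<^sub>L real) list set"
  assumes len: "\<And>\<phi>s. \<phi>s \<in> L \<Longrightarrow> length \<phi>s = n"
  shows "bounded_multilinear n (\<lambda>vs. \<Sum>\<phi>s\<in>L. a \<phi>s * prod_list (map2 blinfun_apply \<phi>s vs))"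
  unfolding bounded_multilinear_def
proof (intro conjI allI impI)
  fix vs :: "'a list" and i
  assume vs: "length vs = n \<and> i < n"
  have "linear (\<lambda>v. a \<phi>s * prod_list (map2 blinfun_apply \<phi>s (vs[i := v])))" if "\<phi>s \<in> L" for \<phi>s
    using linear_prod_list_slot[of \<phi>s vs i] len[OF that] vs by (simp add: linear_iff algebra_simps)
  then show "linear (\<lambda>v. \<Sum>\<phi>s\<in>L. a \<phi>s * prod_list (map2 blinfun_apply \<phi>s (vs[i := v])))"
    by (intro linear_compose_sum) auto
next
  have "\<bar>\<Sum>\<phi>s\<in>L. a \<phi>s * prod_list (map2 blinfun_apply \<phi>s vs)\<bar>
      \<le> (\<Sum>\<phi>s\<in>L. \<bar>a \<phi>s\<bar> * prod_list (map norm \<phi>s)) * prod_list (map norm vs)"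
    if "length vs = n" for vs
    unfolding sum_distrib_right
    by (rule order_trans[OF sum_abs sum_mono])
      (use abs_prod_list_map2_le[of _ vs] len that in \<open>auto simp: abs_mult mult.assoc intro!: mult_left_mono\<close>)
  then show "\<exists>K. \<forall>vs. length vs = n \<longrightarrow> \<bar>\<Sum>\<phi>s\<in>L. a \<phi>s * prod_list (map2 blinfun_apply \<phi>s vs)\<bar>
      \<le> K * prod_list (map norm vs)"
    by blast
qed

text \<open>If every function in \<open>A\<close> has partial derivatives in \<open>A\<close> along a fixed finite set \<open>F\<close> of
  functionals, differentiation can be iterated: the \<open>n\<close>-th derivative is a sum, over words of
  length \<open>n\<close> in \<open>F\<close>, of tensor products of functionals with coefficients in \<open>A\<close>.\<close>

lemma infinitely_differentiable_on_if_closed_under_derivatives: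
  fixes F :: "('a::real_normed_vector \<Rightarrow>\<^sub>L real) set" and A :: "('a \<Rightarrow> real) set"
  assumes F: "finite F"
    and closed: "\<And>g. g \<in> A \<Longrightarrow> \<exists>d. (\<forall>\<phi>\<in>F. d \<phi> \<in> A) \<and>
        (\<forall>x\<in>U. (g has_derivative (\<lambda>h. \<Sum>\<phi>\<in>F. d \<phi> x * blinfun_apply \<phi> h)) (at x))"
    and "f \<in> A"
  shows "infinitely_differentiable_on U f"
proof -
  have "\<forall>g\<in>A. \<exists>d. (\<forall>\<phi>\<in>F. d \<phi> \<in> A) \<and>
        (\<forall>x\<in>U. (g has_derivative (\<lambda>h. \<Sum>\<phi>\<in>F. d \<phi> x * blinfun_apply \<phi> h)) (at x))"
    using closed by blast
  from bchoice[OF this] obtain d where d: "\<forall>g\<in>A. (\<forall>\<phi>\<in>F. d g \<phi> \<in> A) \<and>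
        (\<forall>x\<in>U. (g has_derivative (\<lambda>h. \<Sum>\<phi>\<in>F. d g \<phi> x * blinfun_apply \<phi> h)) (at x))" ..
  have d_in: "d g \<phi> \<in> A" if "g \<in> A" "\<phi> \<in> F" for g \<phi>
    using d that by blast
  have d_deriv: "(g has_derivative (\<lambda>h. \<Sum>\<phi>\<in>F. d g \<phi> x * blinfun_apply \<phi> h)) (at x)"
    if "g \<in> A" "x \<in> U" for g x
    using d that by blast
  define L where "L n = {\<phi>s. set \<phi>s \<subseteq> F \<and> length \<phi>s = n}" for n
  define P where "P \<phi>s = foldr (\<lambda>\<phi> g. d g \<phi>) \<phi>s f" for \<phi>s
  define D where "D n x vs = (\<Sum>\<phi>s\<in>L n. P \<phi>s x * prod_list (map2 blinfun_apply \<phi>s vs))"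
    for n x and vs :: "'a list"
  have fin: "finite (L n)" for n
    unfolding L_def using F by (rule finite_lists_length_eq)
  have P_in: "P \<phi>s \<in> A" if "set \<phi>s \<subseteq> F" for \<phi>s
    using that by (induction \<phi>s) (auto simp: P_def \<open>f \<in> A\<close> d_in)
  have L_Suc: "L (Suc n) = (\<lambda>(\<phi>s, \<phi>). \<phi> # \<phi>s) ` (L n \<times> F)" for n
    unfolding L_def by (rule lists_length_Suc_eq)
  have D_Suc: "D (Suc n) x (h # vs) =
      (\<Sum>\<phi>s\<in>L n. (\<Sum>\<phi>\<in>F. d (P \<phi>s) \<phi> x * blinfun_apply \<phi> h) * prod_list (map2 blinfun_apply \<phi>s vs))"
    for n x h vs
  proof -
    have "D (Suc n) x (h # vs) = (\<Sum>(\<phi>s, \<phi>)\<in>L n \<times> F.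
        d (P \<phi>s) \<phi> x * (blinfun_apply \<phi> h * prod_list (map2 blinfun_apply \<phi>s vs)))"
      unfolding D_def L_Suc by (subst sum.reindex) (auto simp: inj_on_def P_def intro!: sum.cong)
    then show ?thesis
      by (simp add: sum.cartesian_product[symmetric] sum_distrib_right mult.assoc)
  qed
  have "has_multilinear_derivative n (D n) (D (Suc n) x) x" if x: "x \<in> U" for n x
    unfolding has_multilinear_derivative_def
  proof (intro conjI allI impI)
    show "bounded_multilinear (Suc n) (D (Suc n) x)"
      unfolding D_def by (rule bounded_multilinear_sum_tensors) (simp add: L_def)
  next
    fix \<epsilon> :: real assume "\<epsilon> > 0"
    \<comment> \<open>The summand \<open>1\<close> keeps \<open>K\<close> positive when \<open>L n\<close> is empty.\<close>
    define K where "K = 1 + (\<Sum>\<phi>s\<in>L n. prod_list (map norm \<phi>s))"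
    have "K > 0" unfolding K_def
      by (intro add_pos_nonneg sum_nonneg prod_list_map_norm_nonneg) simp
    have "\<forall>\<phi>s\<in>L n. \<exists>\<delta>>0. \<forall>h. norm h < \<delta> \<longrightarrow>
        \<bar>P \<phi>s (x + h) - P \<phi>s x - (\<Sum>\<phi>\<in>F. d (P \<phi>s) \<phi> x * blinfun_apply \<phi> h)\<bar> \<le> \<epsilon> / K * norm h"
    proof
      fix \<phi>s assume "\<phi>s \<in> L n"
      then have "(P \<phi>s has_derivative (\<lambda>h. \<Sum>\<phi>\<in>F. d (P \<phi>s) \<phi> x * blinfun_apply \<phi> h)) (at x)"
        using P_in x by (intro d_deriv) (auto simp: L_def)
      then obtain \<delta> where "\<delta> > 0" and \<delta>: "\<And>y. norm (y - x) < \<delta> \<Longrightarrow>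
          norm (P \<phi>s y - P \<phi>s x - (\<Sum>\<phi>\<in>F. d (P \<phi>s) \<phi> x * blinfun_apply \<phi> (y - x)))
            \<le> \<epsilon> / K * norm (y - x)"
        unfolding has_derivative_at_alt
        using divide_pos_pos[OF \<open>\<epsilon> > 0\<close> \<open>K > 0\<close>] by blast
      show "\<exists>\<delta>>0. \<forall>h. norm h < \<delta> \<longrightarrow>
        \<bar>P \<phi>s (x + h) - P \<phi>s x - (\<Sum>\<phi>\<in>F. d (P \<phi>s) \<phi> x * blinfun_apply \<phi> h)\<bar> \<le> \<epsilon> / K * norm h"
        using \<open>\<delta> > 0\<close> \<delta>[of "x + _"] by auto
    qed
    from bchoice[OF this] obtain \<delta> where \<delta>_all: "\<forall>\<phi>s\<in>L n. \<delta> \<phi>s > 0 \<and> (\<forall>h. norm h < \<delta> \<phi>s \<longrightarrow>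
        \<bar>P \<phi>s (x + h) - P \<phi>s x - (\<Sum>\<phi>\<in>F. d (P \<phi>s) \<phi> x * blinfun_apply \<phi> h)\<bar> \<le> \<epsilon> / K * norm h)" ..
    have \<delta>_pos: "\<delta> \<phi>s > 0" if "\<phi>s \<in> L n" for \<phi>s
      using \<delta>_all that by blast
    have \<delta>: "\<bar>P \<phi>s (x + h) - P \<phi>s x - (\<Sum>\<phi>\<in>F. d (P \<phi>s) \<phi> x * blinfun_apply \<phi> h)\<bar> \<le> \<epsilon> / K * norm h"
      if "\<phi>s \<in> L n" "norm h < \<delta> \<phi>s" for \<phi>s h
      using \<delta>_all that by blast
    define \<delta>0 where "\<delta>0 = Min (insert 1 (\<delta> ` L n))"
    have "\<delta>0 > 0" unfolding \<delta>0_def using fin \<delta>_pos by auto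
    have \<delta>0: "\<delta>0 \<le> \<delta> \<phi>s" if "\<phi>s \<in> L n" for \<phi>s
      unfolding \<delta>0_def using fin that by auto
    have "\<bar>D n (x + h) vs - D n x vs - D (Suc n) x (h # vs)\<bar> \<le> \<epsilon> * norm h * prod_list (map norm vs)"
      if h: "norm h < \<delta>0" and vs: "length vs = n" for h vs
    proof -
      let ?E = "\<lambda>\<phi>s. P \<phi>s (x + h) - P \<phi>s x - (\<Sum>\<phi>\<in>F. d (P \<phi>s) \<phi> x * blinfun_apply \<phi> h)"
      have "D n (x + h) vs - D n x vs - D (Suc n) x (h # vs) =
          (\<Sum>\<phi>s\<in>L n. ?E \<phi>s * prod_list (map2 blinfun_apply \<phi>s vs))"
        unfolding D_Suc unfolding D_def
        by (simp only: sum_subtractf[symmetric] left_diff_distrib)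
      also have "\<bar>\<dots>\<bar> \<le> (\<Sum>\<phi>s\<in>L n. (\<epsilon> / K * norm h) * (prod_list (map norm \<phi>s) * prod_list (map norm vs)))"
      proof (rule order_trans[OF sum_abs sum_mono])
        fix \<phi>s assume \<phi>s: "\<phi>s \<in> L n"
        show "\<bar>?E \<phi>s * prod_list (map2 blinfun_apply \<phi>s vs)\<bar>
            \<le> (\<epsilon> / K * norm h) * (prod_list (map norm \<phi>s) * prod_list (map norm vs))"
          unfolding abs_mult
          using \<delta>[OF \<phi>s] \<delta>0[OF \<phi>s] h abs_prod_list_map2_le[of \<phi>s vs] vs \<phi>s \<open>\<epsilon> > 0\<close> \<open>K > 0\<close>
          by (intro mult_mono) (auto simp: L_def)
      qed
      \<comment> \<open>By choice of \<open>K\<close>, the norms of the words in \<open>L n\<close> sum to \<open>K - 1\<close>.\<close>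
      also have "\<dots> = (\<epsilon> / K * norm h) * (K - 1) * prod_list (map norm vs)"
        by (simp add: K_def sum_distrib_left sum_distrib_right mult.assoc)
      also have "\<dots> \<le> (\<epsilon> / K * norm h) * K * prod_list (map norm vs)"
        using \<open>\<epsilon> > 0\<close> \<open>K > 0\<close>
        by (intro mult_right_mono mult_left_mono prod_list_map_norm_nonneg) auto
      also have "\<dots> = \<epsilon> * norm h * prod_list (map norm vs)"
        using \<open>K > 0\<close> by simp
      finally show ?thesis .
    qed
    then show "\<exists>\<delta>>0. \<forall>h. norm h < \<delta> \<longrightarrow> (\<forall>vs. length vs = n \<longrightarrow>
        \<bar>D n (x + h) vs - D n x vs - D (Suc n) x (h # vs)\<bar> \<le> \<epsilon> * norm h * prod_list (map norm vs))"
      using \<open>\<delta>0 > 0\<close> by blast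
  qed
  moreover have "D 0 x [] = f x" for x
  proof -
    have "L 0 = {[]}" by (auto simp: L_def)
    then show ?thesis by (simp add: D_def P_def)
  qed
  ultimately show ?thesis
    unfolding infinitely_differentiable_on_def by blast
qed

text \<open>Evaluation at fixed arguments reduces uniqueness of multilinear derivatives to that of
  ordinary ones.\<close>

lemma has_multilinear_derivative_imp_has_derivative:
  assumes "has_multilinear_derivative n F T x" "length vs = n"
  shows "((\<lambda>y. F y vs) has_derivative (\<lambda>h. T (h # vs))) (at x)"
  unfolding has_derivative_at_alt
proof (intro conjI allI impI)
  have lin: "linear (\<lambda>v. T ((0 # vs)[0 := v]))"
    using assms unfolding has_multilinear_derivative_def bounded_multilinear_def
    by (metis length_Cons zero_less_Suc)
  obtain K where K: "\<And>ws. length ws = Suc n \<Longrightarrow> \<bar>T ws\<bar> \<le> K * prod_list (map norm ws)"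
    using assms unfolding has_multilinear_derivative_def bounded_multilinear_def by blast
  show "bounded_linear (\<lambda>h. T (h # vs))"
  proof (rule bounded_linear.intro)
    show "linear (\<lambda>h. T (h # vs))" using lin by simp
    show "bounded_linear_axioms (\<lambda>h. T (h # vs))"
      by standard (use K[of "_ # vs"] assms(2) in
        \<open>auto simp: mult_ac intro!: exI[of _ "K * prod_list (map norm vs)"]\<close>)
  qed
next
  fix e :: real assume "e > 0"
  define p where "p = prod_list (map norm vs)"
  have p: "p \<ge> 0" unfolding p_def by (rule prod_list_map_norm_nonneg)
  then have pos: "e / (p + 1) > 0" using \<open>e > 0\<close> by simp
  have le: "e / (p + 1) * r * p \<le> e * r" if "r \<ge> 0" for r
    using p that \<open>e > 0\<close> by (simp add: field_simps)
  obtain \<delta> where "\<delta> > 0" and \<delta>: "\<And>h. norm h < \<delta> \<Longrightarrow>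
      \<bar>F (x + h) vs - F x vs - T (h # vs)\<bar> \<le> e / (p + 1) * norm h * p"
    using assms pos unfolding has_multilinear_derivative_def p_def by metis
  show "\<exists>d>0. \<forall>y. norm (y - x) < d \<longrightarrow>
      norm (F y vs - F x vs - T ((y - x) # vs)) \<le> e * norm (y - x)"
  proof (intro exI[of _ \<delta>] conjI allI impI)
    fix y assume "norm (y - x) < \<delta>"
    then show "norm (F y vs - F x vs - T ((y - x) # vs)) \<le> e * norm (y - x)"
      using \<delta>[of "y - x"] le[of "norm (y - x)"] by simp
  qed (rule \<open>\<delta> > 0\<close>)
qed

lemma multilinear_derivatives_agree:
  fixes f :: "'a::real_normed_vector \<Rightarrow> real"
  assumes S: "open S"
    and D0: "\<And>x. x \<in> S \<Longrightarrow> D 0 x [] = f x" and E0: "\<And>x. x \<in> S \<Longrightarrow> E 0 x [] = f x"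
    and D: "\<And>n x. x \<in> S \<Longrightarrow> has_multilinear_derivative n (D n) (D (Suc n) x) x"
    and E: "\<And>n x. x \<in> S \<Longrightarrow> has_multilinear_derivative n (E n) (E (Suc n) x) x"
  shows "x \<in> S \<Longrightarrow> length vs = n \<Longrightarrow> D n x vs = E n x vs"
proof (induction n arbitrary: x vs)
  case 0
  then show ?case using D0 E0 by simp
next
  case (Suc n)
  then obtain h ws where vs: "vs = h # ws" "length ws = n"
    by (auto simp: length_Suc_conv)
  have "((\<lambda>y. E n y ws) has_derivative (\<lambda>h. D (Suc n) x (h # ws))) (at x)"
    by (rule has_derivative_transform_within_open
        [OF has_multilinear_derivative_imp_has_derivative[OF D] S])
      (use Suc vs in auto)
  moreover have "((\<lambda>y. E n y ws) has_derivative (\<lambda>h. E (Suc n) x (h # ws))) (at x)"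
    using Suc vs E by (intro has_multilinear_derivative_imp_has_derivative) auto
  ultimately show ?case
    using has_derivative_unique vs by metis
qed

text \<open>Local towers of derivatives can be glued because derivatives are unique.\<close>

lemma infinitely_differentiable_on_locally:
  fixes f :: "'a::real_normed_vector \<Rightarrow> real"
  assumes S: "open S"
    and loc: "\<And>x. x \<in> S \<Longrightarrow> \<exists>U. open U \<and> x \<in> U \<and> infinitely_differentiable_on U f"
  shows "infinitely_differentiable_on S f"
proof -
  obtain U where U: "\<And>x. x \<in> S \<Longrightarrow> open (U x)" "\<And>x. x \<in> S \<Longrightarrow> x \<in> U x"
    and diff: "\<And>x. x \<in> S \<Longrightarrow> infinitely_differentiable_on (U x) f"
    using loc by metis
  have "\<exists>D. (\<forall>y\<in>U x. D 0 y [] = f y) \<and>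
      (\<forall>n. \<forall>y\<in>U x. has_multilinear_derivative n (D n) (D (Suc n) y) y)" if "x \<in> S" for x
    using diff[OF that] unfolding infinitely_differentiable_on_def .
  then obtain D where D0: "\<And>x y. x \<in> S \<Longrightarrow> y \<in> U x \<Longrightarrow> D x 0 y [] = f y"
    and D: "\<And>x y n. x \<in> S \<Longrightarrow> y \<in> U x \<Longrightarrow> has_multilinear_derivative n (D x n) (D x (Suc n) y) y"
    by metis
  have agree: "D y n y vs = D x n y vs" if "x \<in> S" "y \<in> S" "y \<in> U x" "length vs = n" for x y n vs
    by (rule multilinear_derivatives_agree[of "U x \<inter> U y" "D y" f "D x"])
      (use that U D0 D in auto)
  define G where "G n y = D y n y" for n y
  have "has_multilinear_derivative n (G n) (G (Suc n) x) x" if x: "x \<in> S" for n x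
    unfolding has_multilinear_derivative_def
  proof (intro conjI allI impI)
    have Dx: "has_multilinear_derivative n (D x n) (D x (Suc n) x) x"
      using D U x by blast
    then show "bounded_multilinear (Suc n) (G (Suc n) x)"
      unfolding has_multilinear_derivative_def G_def by blast
    fix \<epsilon> :: real assume "\<epsilon> > 0"
    then obtain \<delta> where "\<delta> > 0" and \<delta>: "\<And>h vs. norm h < \<delta> \<Longrightarrow> length vs = n \<Longrightarrow>
        \<bar>D x n (x + h) vs - D x n x vs - D x (Suc n) x (h # vs)\<bar> \<le> \<epsilon> * norm h * prod_list (map norm vs)"
      using Dx unfolding has_multilinear_derivative_def by blast
    obtain \<rho> where "\<rho> > 0" and \<rho>: "ball x \<rho> \<subseteq> S \<inter> U x"
      using U x S by (metis IntI open_Int open_contains_ball)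
    have in_ball: "x + h \<in> S \<inter> U x" if "norm h < \<rho>" for h
      using \<rho> that by (auto simp: dist_norm)
    show "\<exists>\<delta>>0. \<forall>h. norm h < \<delta> \<longrightarrow> (\<forall>vs. length vs = n \<longrightarrow>
        \<bar>G n (x + h) vs - G n x vs - G (Suc n) x (h # vs)\<bar> \<le> \<epsilon> * norm h * prod_list (map norm vs))"
    proof (intro exI[of _ "min \<delta> \<rho>"] conjI allI impI)
      fix h :: 'a and vs :: "'a list" assume "norm h < min \<delta> \<rho>" "length vs = n"
      then show "\<bar>G n (x + h) vs - G n x vs - G (Suc n) x (h # vs)\<bar> \<le> \<epsilon> * norm h * prod_list (map norm vs)"
        using \<delta>[of h vs] agree[of x "x + h" vs n] in_ball[of h] x by (simp add: G_def)
    qed (use \<open>\<delta> > 0\<close> \<open>\<rho> > 0\<close> in auto)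
  qed
  then show ?thesis
    unfolding infinitely_differentiable_on_def
    using D0 U by (intro exI[of _ G]) (auto simp: G_def)
qed

section \<open>Bootstrapping smoothness from a first order equation\<close>

text \<open>All functions that repeated differentiation of \<open>N\<close> can produce when the derivative of \<open>N\<close>
  has coefficients of this form; \<open>\<psi> m\<close> stands for the \<open>m\<close>-th derivative of one smooth function
  of a real variable.\<close>

inductive_set generated_algebra ::
  "('a::real_normed_vector \<Rightarrow>\<^sub>L real) set \<Rightarrow> (nat \<Rightarrow> real \<Rightarrow> real) \<Rightarrow> 'a set \<Rightarrow> ('a \<Rightarrow> real) \<Rightarrow> ('a \<Rightarrow> real) set"
  for F \<psi> U N where
  const: "(\<lambda>_. c) \<in> generated_algebra F \<psi> U N"
| functional: "\<phi> \<in> F \<Longrightarrow> blinfun_apply \<phi> \<in> generated_algebra F \<psi> U N"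
| base: "N \<in> generated_algebra F \<psi> U N"
| add: "g \<in> generated_algebra F \<psi> U N \<Longrightarrow> h \<in> generated_algebra F \<psi> U N \<Longrightarrow>
    (\<lambda>x. g x + h x) \<in> generated_algebra F \<psi> U N"
| mult: "g \<in> generated_algebra F \<psi> U N \<Longrightarrow> h \<in> generated_algebra F \<psi> U N \<Longrightarrow>
    (\<lambda>x. g x * h x) \<in> generated_algebra F \<psi> U N"
| inverse: "g \<in> generated_algebra F \<psi> U N \<Longrightarrow> (\<And>x. x \<in> U \<Longrightarrow> g x \<noteq> 0) \<Longrightarrow>
    (\<lambda>x. inverse (g x)) \<in> generated_algebra F \<psi> U N"
| comp: "g \<in> generated_algebra F \<psi> U N \<Longrightarrow> (\<lambda>x. \<psi> m (g x)) \<in> generated_algebra F \<psi> U N"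

lemma generated_algebra_sum:
  assumes "\<And>j. j \<in> J \<Longrightarrow> g j \<in> generated_algebra F \<psi> U N"
  shows "(\<lambda>x. \<Sum>j\<in>J. g j x) \<in> generated_algebra F \<psi> U N"
  using assms
  by (induction J rule: infinite_finite_induct)
    (auto intro: generated_algebra.const generated_algebra.add)

text \<open>A bootstrapping principle that takes the place of an implicit function theorem of class
  \<open>C\<^sup>\<infinity>\<close>: a function that solves a first order equation \<open>N' = \<Sum> a \<phi> \<cdot> \<phi>\<close>, with coefficients
  expressed through \<open>N\<close> itself, is as smooth as the expression allows, that is, infinitely
  differentiable.\<close>

lemma infinitely_differentiable_on_if_derivative_in_generated_algebra:
  fixes F :: "('a::real_normed_vector \<Rightarrow>\<^sub>L real) set"
  assumes F: "finite F"
    and \<psi>: "\<And>m s. (\<psi> m has_field_derivative \<psi> (Suc m) s) (at s)"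
    and a: "\<And>\<phi>. \<phi> \<in> F \<Longrightarrow> a \<phi> \<in> generated_algebra F \<psi> U N"
    and N: "\<And>x. x \<in> U \<Longrightarrow> (N has_derivative (\<lambda>h. \<Sum>\<phi>\<in>F. a \<phi> x * blinfun_apply \<phi> h)) (at x)"
  shows "infinitely_differentiable_on U N"
proof (rule infinitely_differentiable_on_if_closed_under_derivatives[OF F _ generated_algebra.base])
  let ?A = "generated_algebra F \<psi> U N"
  let ?lin = "\<lambda>d x h. \<Sum>\<phi>\<in>F. d \<phi> x * blinfun_apply \<phi> h"
  fix g assume "g \<in> ?A"
  then show "\<exists>d. (\<forall>\<phi>\<in>F. d \<phi> \<in> ?A) \<and> (\<forall>x\<in>U. (g has_derivative ?lin d x) (at x))"
  proof induction
    case (const c)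
    show ?case
      by (rule exI[of _ "\<lambda>_ _. 0"]) (auto intro: generated_algebra.const)
  next
    case (functional \<phi>)
    let ?d = "\<lambda>\<theta> _. if \<theta> = \<phi> then 1 else (0::real)"
    have "?lin ?d x = blinfun_apply \<phi>" for x
      using F functional by (intro ext) (simp add: if_distrib[of "\<lambda>c. c * _"] sum.delta cong: if_cong)
    moreover have "?d \<theta> \<in> ?A" for \<theta>
      by (cases "\<theta> = \<phi>") (auto intro: generated_algebra.const)
    moreover have "(blinfun_apply \<phi> has_derivative blinfun_apply \<phi>) (at x)" for x
      by (rule bounded_linear_imp_has_derivative) (rule blinfun.bounded_linear_right)
    ultimately show ?case by (intro exI[of _ ?d]) simp
  next
    case base
    show ?case using a N by (intro exI[of _ a]) auto
  next
    case (add g h)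
    then obtain d e where d: "\<forall>\<phi>\<in>F. d \<phi> \<in> ?A" "\<forall>x\<in>U. (g has_derivative ?lin d x) (at x)"
      and e: "\<forall>\<phi>\<in>F. e \<phi> \<in> ?A" "\<forall>x\<in>U. (h has_derivative ?lin e x) (at x)" by auto
    let ?k = "\<lambda>\<phi> x. d \<phi> x + e \<phi> x"
    have "?lin ?k x = (\<lambda>v. ?lin d x v + ?lin e x v)" for x
      by (simp add: distrib_right sum.distrib)
    then show ?case
      using d e by (intro exI[of _ ?k]) (auto intro: generated_algebra.add has_derivative_add)
  next
    case (mult g h)
    then obtain d e where d: "\<forall>\<phi>\<in>F. d \<phi> \<in> ?A" "\<forall>x\<in>U. (g has_derivative ?lin d x) (at x)"
      and e: "\<forall>\<phi>\<in>F. e \<phi> \<in> ?A" "\<forall>x\<in>U. (h has_derivative ?lin e x) (at x)" by auto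
    let ?k = "\<lambda>\<phi> x. g x * e \<phi> x + d \<phi> x * h x"
    have "?lin ?k x = (\<lambda>v. g x * ?lin e x v + ?lin d x v * h x)" for x
      by (intro ext) (simp add: algebra_simps sum.distrib sum_distrib_left)
    then show ?case
      using d e mult.hyps
      by (intro exI[of _ ?k]) (auto intro!: generated_algebra.add generated_algebra.mult has_derivative_mult)
  next
    case (inverse g)
    then obtain d where d: "\<forall>\<phi>\<in>F. d \<phi> \<in> ?A" "\<forall>x\<in>U. (g has_derivative ?lin d x) (at x)" by auto
    let ?k = "\<lambda>\<phi> x. (-1) * (inverse (g x) * d \<phi> x * inverse (g x))"
    have "?lin ?k x = (\<lambda>v. - (inverse (g x) * ?lin d x v * inverse (g x)))" for x
      by (simp add: sum_distrib_left sum_distrib_right sum_negf mult_ac)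
    moreover have "?k \<phi> \<in> ?A" if "\<phi> \<in> F" for \<phi>
      using d inverse.hyps that
      by (intro generated_algebra.mult generated_algebra.inverse generated_algebra.const) auto
    ultimately show ?case
      using d inverse.hyps by (intro exI[of _ ?k]) (auto intro!: Deriv.has_derivative_inverse)
  next
    case (comp g m)
    then obtain d where d: "\<forall>\<phi>\<in>F. d \<phi> \<in> ?A" "\<forall>x\<in>U. (g has_derivative ?lin d x) (at x)" by auto
    let ?k = "\<lambda>\<phi> x. \<psi> (Suc m) (g x) * d \<phi> x"
    have eq: "?lin ?k x = (\<lambda>v. \<psi> (Suc m) (g x) * ?lin d x v)" for x
      by (simp add: sum_distrib_left mult_ac)
    have "((\<lambda>y. \<psi> m (g y)) has_derivative ?lin ?k x) (at x)" if "x \<in> U" for x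
      unfolding eq
      using has_derivative_compose[of g "?lin d x" x UNIV "\<psi> m" "(*) (\<psi> (Suc m) (g x))"]
        \<psi>[of m "g x"] d that by (simp add: has_field_derivative_def)
    moreover have "?k \<phi> \<in> ?A" if "\<phi> \<in> F" for \<phi>
      using d comp.hyps that by (intro generated_algebra.mult generated_algebra.comp) auto
    ultimately show ?case by (intro exI[of _ ?k]) auto
  qed
qed

section \<open>Minkowski gauges and equivalent norms\<close>

definition minkowski_gauge :: "'a::real_vector set \<Rightarrow> 'a \<Rightarrow> real" where
  "minkowski_gauge C x = Inf {t. 0 < t \<and> x /\<^sub>R t \<in> C}"

text \<open>The infimum bound gives \<open>x / s \<in> C\<close> only for \<open>s > t\<close>; closedness yields it for \<open>t\<close>. The ball
  inside \<open>C\<close> makes the infimum one over a nonempty set.\<close>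

lemma minkowski_gauge_le_iff:
  fixes C :: "'a::real_normed_vector set"
  assumes C: "convex C" "closed C" and r: "r > 0" "cball 0 r \<subseteq> C" and "t > 0"
  shows "minkowski_gauge C x \<le> t \<longleftrightarrow> x /\<^sub>R t \<in> C"
proof
  let ?T = "{t. 0 < t \<and> x /\<^sub>R t \<in> C}"
  have bdd: "bdd_below ?T" by (rule bdd_belowI[of _ 0]) auto
  show "minkowski_gauge C x \<le> t" if "x /\<^sub>R t \<in> C"
    unfolding minkowski_gauge_def using that \<open>t > 0\<close> bdd by (intro cInf_lower) auto
  assume le: "minkowski_gauge C x \<le> t"
  have "x /\<^sub>R ((norm x + 1) / r) \<in> cball 0 r"
  proof -
    have "r * (norm x / (norm x + 1)) \<le> r * 1"
      using r by (intro mult_left_mono) (simp_all add: divide_le_eq_1 add_nonneg_pos)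
    then show ?thesis using r by (simp add: mult.commute divide_inverse abs_mult add_nonneg_nonneg)
  qed
  then have "(norm x + 1) / r \<in> ?T"
    using r by (auto intro!: divide_pos_pos add_nonneg_pos)
  then have ne: "?T \<noteq> {}" by blast
  have scaled: "x /\<^sub>R s \<in> C" if "s > t" for s
  proof -
    have "Inf ?T < s" using le that unfolding minkowski_gauge_def by simp
    then obtain u where u: "0 < u" "x /\<^sub>R u \<in> C" "u < s"
      using cInf_lessD[OF ne] by auto
    have "(u / s) *\<^sub>R (x /\<^sub>R u) + (1 - u / s) *\<^sub>R 0 \<in> C"
      using u r by (intro convexD[OF C(1)]) auto
    then show ?thesis using u by (simp add: divide_inverse_commute mult.assoc)
  qed
  have lim: "((\<lambda>s. x /\<^sub>R s) \<longlongrightarrow> x /\<^sub>R t) (at_right t)"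
    using \<open>t > 0\<close> by (intro tendsto_intros) auto
  show "x /\<^sub>R t \<in> C"
    by (rule Lim_in_closed_set[OF C(2) _ trivial_limit_at_right_real lim])
      (use scaled in \<open>auto simp: eventually_at_filter\<close>)
qed

lemma equivalent_norm_minkowski_gauge:
  fixes C :: "'a::real_normed_vector set"
  assumes C: "convex C" "closed C" and sym: "\<And>x. x \<in> C \<Longrightarrow> - x \<in> C"
    and r: "r > 0" "cball 0 r \<subseteq> C" and R: "R > 0" "C \<subseteq> cball 0 R"
  shows "equivalent_norm (minkowski_gauge C)"
proof -
  let ?N = "minkowski_gauge C"
  note le_iff = minkowski_gauge_le_iff[OF C r]
  have le_cong: "a = b" if "\<And>t. t > 0 \<Longrightarrow> a \<le> t \<longleftrightarrow> b \<le> t" "0 \<le> a" "0 \<le> b" for a b :: real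
    using that(1)[of "(a + b) / 2"] that(2,3) by (cases a b rule: linorder_cases) auto
  have lower: "norm x / R \<le> ?N x" for x
  proof (rule dense_ge)
    fix t assume t: "?N x < t"
    show "norm x / R \<le> t"
    proof (cases "t > 0")
      case True
      then have "x /\<^sub>R t \<in> C" using le_iff less_imp_le[OF t] by blast
      then have "norm (x /\<^sub>R t) \<le> R" using R by auto
      then show ?thesis using True R by (simp add: field_simps)
    next
      case False
      then have small: "x /\<^sub>R u \<in> C" if "u > 0" for u
      proof -
        have "?N x \<le> u" using t that False by linarith
        then show ?thesis using le_iff[OF that] by blast
      qed
      have "norm x \<le> R * u" if "u > 0" for u
      proof -
        have "norm (x /\<^sub>R u) \<le> R" using small[OF that] R by auto
        then show ?thesis using that by (simp add: field_simps)
      qed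
      have "0 \<le> ?N x" unfolding minkowski_gauge_def
        by (rule cInf_greatest) (use small[of 1] in \<open>auto intro: exI[of _ 1]\<close>)
      then show ?thesis using t False by linarith
    qed
  qed
  have nonneg: "0 \<le> ?N x" for x
    using order_trans[OF _ lower[of x]] R by simp
  have upper: "?N x \<le> norm x / r" for x
  proof (cases "x = 0")
    case True
    have "?N x \<le> t" if "t > 0" for t using le_iff[OF that, of x] r True by auto
    then show ?thesis using True by (simp add: field_le_epsilon)
  next
    case False
    then have "x /\<^sub>R (norm x / r) \<in> cball 0 r" using r by simp
    then show ?thesis using le_iff[of "norm x / r" x] r False by auto
  qed
  have zero: "?N x = 0 \<longleftrightarrow> x = 0" for x
    using lower[of x] upper[of x] nonneg[of x] R by (auto simp: field_simps)
  have uminus: "- x \<in> C \<longleftrightarrow> x \<in> C" for x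
    using sym[of x] sym[of "- x"] by auto
  have scale: "?N (c *\<^sub>R x) = \<bar>c\<bar> * ?N x" for c x
  proof (cases "c = 0")
    case True
    then show ?thesis using zero[of 0] by simp
  next
    case False
    show ?thesis
    proof (rule le_cong)
      fix t :: real assume "t > 0"
      have "?N (c *\<^sub>R x) \<le> t \<longleftrightarrow> (c *\<^sub>R x) /\<^sub>R t \<in> C" using le_iff \<open>t > 0\<close> .
      also have "\<dots> \<longleftrightarrow> x /\<^sub>R (t / \<bar>c\<bar>) \<in> C"
        using uminus[of "x /\<^sub>R (t / \<bar>c\<bar>)"] False
        by (cases "c > 0") (auto simp: divide_inverse_commute mult.commute)
      also have "\<dots> \<longleftrightarrow> ?N x \<le> t / \<bar>c\<bar>" using le_iff[of "t / \<bar>c\<bar>"] \<open>t > 0\<close> False by simp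
      also have "\<dots> \<longleftrightarrow> \<bar>c\<bar> * ?N x \<le> t" using False by (simp add: field_simps)
      finally show "?N (c *\<^sub>R x) \<le> t \<longleftrightarrow> \<bar>c\<bar> * ?N x \<le> t" .
    qed (simp_all add: nonneg)
  qed
  have triangle: "?N (x + y) \<le> ?N x + ?N y" for x y
  proof (rule field_le_epsilon)
    fix e :: real assume "e > 0"
    define s where "s = ?N x + e / 2"
    define t where "t = ?N y + e / 2"
    have st: "s > 0" "t > 0" unfolding s_def t_def using nonneg[of x] nonneg[of y] \<open>e > 0\<close> by auto
    have "x /\<^sub>R s \<in> C" "y /\<^sub>R t \<in> C"
      using le_iff[OF st(1), of x] le_iff[OF st(2), of y] \<open>e > 0\<close> by (auto simp: s_def t_def)
    then have "(s / (s + t)) *\<^sub>R (x /\<^sub>R s) + (t / (s + t)) *\<^sub>R (y /\<^sub>R t) \<in> C"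
      using st by (intro convexD[OF C(1)]) (auto simp: add_divide_distrib[symmetric])
    then have "(x + y) /\<^sub>R (s + t) \<in> C"
      using st by (simp add: scaleR_add_right divide_inverse_commute mult.assoc)
    then show "?N (x + y) \<le> ?N x + ?N y + e"
      using le_iff[of "s + t" "x + y"] st by (simp add: s_def t_def)
  qed
  have "1 / R * norm x \<le> ?N x \<and> ?N x \<le> 1 / r * norm x" for x
    using lower[of x] upper[of x] by simp
  moreover have "1 / R > 0" "1 / r > 0" using r R by auto
  ultimately show ?thesis
    unfolding equivalent_norm_def is_norm_def using zero scale triangle by blast
qed

lemma equivalent_normD:
  assumes "equivalent_norm N"
  shows "N (c *\<^sub>R x) = \<bar>c\<bar> * N x" "N (x + y) \<le> N x + N y" "0 \<le> N x" "N x = 0 \<longleftrightarrow> x = 0" "x \<noteq> 0 \<Longrightarrow> 0 < N x"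
proof -
  note norm = assms[unfolded equivalent_norm_def is_norm_def]
  show "N (c *\<^sub>R x) = \<bar>c\<bar> * N x" "N (x + y) \<le> N x + N y" and zero: "N x = 0 \<longleftrightarrow> x = 0"
    using norm by blast+
  obtain a where "a > 0" "a * norm x \<le> N x" using norm by blast
  then show "0 \<le> N x" by (meson less_imp_le mult_nonneg_nonneg norm_ge_zero order_trans)
  then show "x \<noteq> 0 \<Longrightarrow> 0 < N x" using zero by simp
qed

lemma equivalent_norm_lipschitz:
  assumes "equivalent_norm N"
  obtains b where "b > 0" "\<And>x y. \<bar>N x - N y\<bar> \<le> b * norm (x - y)"
proof -
  obtain b where b: "b > 0" "\<And>x. N x \<le> b * norm x"
    using assms unfolding equivalent_norm_def by blast
  have "N x - N y \<le> b * norm (x - y)" for x y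
    using equivalent_normD(2)[OF assms, of "x - y" y] b(2)[of "x - y"] by simp
  then have "\<bar>N x - N y\<bar> \<le> b * norm (x - y)" for x y
    by (metis abs_le_iff minus_diff_eq norm_minus_commute)
  then show thesis using b that by blast
qed

lemma equivalent_norm_continuous_on:
  assumes "equivalent_norm N"
  shows "continuous_on S N"
proof -
  obtain b where b: "b > 0" "\<And>x y. \<bar>N x - N y\<bar> \<le> b * norm (x - y)"
    using equivalent_norm_lipschitz[OF assms] by blast
  have "b-lipschitz_on S N"
    using b by (intro lipschitz_onI) (auto simp: dist_norm)
  then show ?thesis by (rule lipschitz_on_continuous_on)
qed

lemma continuous_on_normalize:
  assumes "equivalent_norm N"
  shows "continuous_on (- {0}) (\<lambda>x. x /\<^sub>R N x)"
proof (intro continuous_on_scaleR continuous_on_inverse continuous_on_id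
    equivalent_norm_continuous_on[OF assms])
  show "\<forall>x\<in>- {0}. N x \<noteq> 0" using equivalent_normD(4)[OF assms] by blast
qed

text \<open>Implicit differentiation at first order. If the unit sphere is a level set of \<open>\<Phi>\<close> near the
  normalization \<open>z\<close> of \<open>x\<close>, if \<open>A\<close> is the derivative of \<open>\<Phi>\<close> at \<open>z\<close> and \<open>w\<close> is the normalization
  of \<open>y\<close>, then \<open>A (w - z)\<close> is small compared with \<open>w - z\<close>.
  Multiplication by \<open>N y\<close> turns \<open>w - z\<close> into \<open>(y - x) - (N y - N x) z\<close>, so that
  \<open>A (y - x) - (N y - N x) A z\<close> is small compared with \<open>y - x\<close>; division by \<open>A z\<close> gives the
  derivative of \<open>N\<close>.\<close>

lemma equivalent_norm_has_derivative_if_level_set: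
  fixes N :: "'a::real_normed_vector \<Rightarrow> real"
  assumes N: "equivalent_norm N"
    and U: "open U" "x \<in> U" "0 \<notin> U"
    and level: "\<And>y. y \<in> U \<Longrightarrow> \<Phi> (y /\<^sub>R N y) = c"
    and \<Phi>: "(\<Phi> has_derivative A) (at (x /\<^sub>R N x))"
    and transversal: "A (x /\<^sub>R N x) \<noteq> 0"
  shows "(N has_derivative (\<lambda>h. A h / A (x /\<^sub>R N x))) (at x)"
  unfolding has_derivative_at_alt
proof (intro conjI allI impI)
  define z where "z = x /\<^sub>R N x"
  have A: "bounded_linear A" using \<Phi> by (rule has_derivative_bounded_linear)
  then show "bounded_linear (\<lambda>h. A h / A (x /\<^sub>R N x))"
    using bounded_linear_compose[OF bounded_linear_divide] by blast
  have x: "x \<noteq> 0" using U by auto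
  have Nx: "N x > 0" using equivalent_normD(5)[OF N x] .
  then have x_eq: "x = N x *\<^sub>R z" by (simp add: z_def)
  obtain b where b: "b > 0" "\<And>x y. \<bar>N x - N y\<bar> \<le> b * norm (x - y)"
    using equivalent_norm_lipschitz[OF N] by blast
  fix e :: real assume "e > 0"
  define K where "K = 1 + b * norm z"
  have K: "K > 0" unfolding K_def using b by (intro add_pos_nonneg) auto
  define e' where "e' = e * \<bar>A z\<bar> / K"
  have "e' > 0" unfolding e'_def using \<open>e > 0\<close> K transversal by (simp add: z_def)
  then obtain d1 where "d1 > 0" and d1: "\<And>w. norm (w - z) < d1 \<Longrightarrow>
      \<bar>\<Phi> w - \<Phi> z - A (w - z)\<bar> \<le> e' * norm (w - z)"
    using \<Phi> unfolding has_derivative_at_alt z_def real_norm_def by blast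
  have "isCont (\<lambda>y. y /\<^sub>R N y) x"
    using continuous_on_normalize[OF N] x by (simp add: continuous_on_eq_continuous_at open_Compl)
  then obtain d2 where "d2 > 0" and d2: "\<And>y. norm (y - x) < d2 \<Longrightarrow> norm (y /\<^sub>R N y - z) < d1"
    unfolding continuous_at_eps_delta using \<open>d1 > 0\<close> by (auto simp: dist_norm z_def)
  obtain d3 where "d3 > 0" and d3: "ball x d3 \<subseteq> U"
    using U open_contains_ball by blast
  show "\<exists>d>0. \<forall>y. norm (y - x) < d \<longrightarrow>
      norm (N y - N x - A (y - x) / A (x /\<^sub>R N x)) \<le> e * norm (y - x)"
  proof (intro exI[of _ "min d2 d3"] conjI allI impI)
    fix y assume y: "norm (y - x) < min d2 d3"
    then have "y \<in> U" using d3 by (auto simp: dist_norm norm_minus_commute)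
    define w where "w = y /\<^sub>R N y"
    have Ny: "N y > 0" using equivalent_normD(5)[OF N] \<open>y \<in> U\<close> U by metis
    have y_eq: "y = N y *\<^sub>R w" using Ny by (simp add: w_def)
    have "\<Phi> w = \<Phi> z" using level \<open>y \<in> U\<close> U by (simp add: w_def z_def)
    then have "\<bar>A (w - z)\<bar> \<le> e' * norm (w - z)"
      using d1[of w] d2[of y] y by (simp add: w_def)
    then have *: "N y * \<bar>A (w - z)\<bar> \<le> e' * (N y * norm (w - z))"
      using Ny by (simp add: mult.left_commute)
    interpret A: bounded_linear A by (rule A)
    have diff: "N y *\<^sub>R (w - z) = (y - x) - (N y - N x) *\<^sub>R z"
      unfolding scaleR_diff_right scaleR_diff_left y_eq[symmetric] x_eq[symmetric] by simp
    have "N y * norm (w - z) = norm (N y *\<^sub>R (w - z))" using Ny by simp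
    also have "\<dots> \<le> norm (y - x) + \<bar>N y - N x\<bar> * norm z"
      unfolding diff by (rule order_trans[OF norm_triangle_ineq4]) simp
    also have "\<dots> \<le> norm (y - x) + (b * norm (y - x)) * norm z"
      using b(2)[of y x] by (intro add_left_mono mult_right_mono) auto
    also have "\<dots> = K * norm (y - x)" by (simp add: K_def algebra_simps)
    finally have size: "N y * norm (w - z) \<le> K * norm (y - x)" .
    have "N y * \<bar>A (w - z)\<bar> = \<bar>A (N y *\<^sub>R (w - z))\<bar>" using Ny by (simp add: A.scaleR abs_mult)
    also have "A (N y *\<^sub>R (w - z)) = A (y - x) - (N y - N x) * A z"
      unfolding diff by (simp add: A.diff A.scaleR)
    finally have "\<bar>A (y - x) - (N y - N x) * A z\<bar> \<le> e' * (K * norm (y - x))"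
      using * size \<open>e' > 0\<close> by (smt (verit) mult_left_mono)
    also have "\<dots> = (e * norm (y - x)) * \<bar>A z\<bar>" using K by (simp add: e'_def)
    finally have main: "\<bar>A (y - x) - (N y - N x) * A z\<bar> \<le> (e * norm (y - x)) * \<bar>A z\<bar>" .
    have Az: "A z \<noteq> 0" using transversal by (simp add: z_def)
    have "\<bar>N y - N x - A (y - x) / A z\<bar> * \<bar>A z\<bar> = \<bar>(N y - N x) * A z - A (y - x)\<bar>"
      unfolding abs_mult[symmetric] using Az by (simp add: left_diff_distrib)
    then have "\<bar>N y - N x - A (y - x) / A z\<bar> * \<bar>A z\<bar> \<le> (e * norm (y - x)) * \<bar>A z\<bar>"
      using main by (simp add: abs_minus_commute)
    then show "norm (N y - N x - A (y - x) / A (x /\<^sub>R N x)) \<le> e * norm (y - x)"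
      using Az unfolding z_def[symmetric] by simp
  qed (use \<open>d2 > 0\<close> \<open>d3 > 0\<close> in auto)
qed

section \<open>Gauges of bodies cut out by smooth penalties\<close>

definition barrier :: "(('a::real_normed_vector \<Rightarrow>\<^sub>L real) \<times> real) set \<Rightarrow> 'a \<Rightarrow> real" where
  "barrier J x = (\<Sum>p\<in>J. flat_exp 0 (blinfun_apply (fst p) x - snd p))"

text \<open>Finite partial sums avoid any question of convergence far away from the body.\<close>

definition barrier_body :: "(('a::real_normed_vector \<Rightarrow>\<^sub>L real) \<times> real) set \<Rightarrow> 'a set" where
  "barrier_body I = {x. \<forall>J\<subseteq>I. finite J \<longrightarrow> barrier J x \<le> 1}"

lemma barrier_has_derivative:
  "(barrier J has_derivative
      (\<lambda>h. \<Sum>p\<in>J. flat_exp 1 (blinfun_apply (fst p) x - snd p) * blinfun_apply (fst p) h)) (at x)"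
  unfolding barrier_def
proof (rule has_derivative_sum)
  fix p :: "('a \<Rightarrow>\<^sub>L real) \<times> real"
  have "((\<lambda>x. blinfun_apply (fst p) x - snd p) has_derivative blinfun_apply (fst p)) (at x)"
    by (auto intro!: derivative_eq_intros bounded_linear_imp_has_derivative blinfun.bounded_linear_right)
  from has_derivative_compose[OF this, of "flat_exp 0" "(*) (flat_exp 1 (blinfun_apply (fst p) x - snd p))"]
  show "((\<lambda>x. flat_exp 0 (blinfun_apply (fst p) x - snd p)) has_derivative
      (\<lambda>h. flat_exp 1 (blinfun_apply (fst p) x - snd p) * blinfun_apply (fst p) h)) (at x)"
    using flat_exp_has_field_derivative[of 0] by (simp add: has_field_derivative_def)
qed

lemma continuous_on_barrier: "continuous_on S (barrier J)"
  by (intro continuous_at_imp_continuous_on ballI has_derivative_continuous[OF barrier_has_derivative])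

lemma closed_barrier_body: "closed (barrier_body I)"
proof -
  have "barrier_body I = (\<Inter>J\<in>{J. J \<subseteq> I \<and> finite J}. {x. barrier J x \<le> 1})"
    by (auto simp: barrier_body_def)
  then show ?thesis
    by (auto intro!: closed_INT closed_Collect_le continuous_on_barrier continuous_on_const)
qed

lemma convex_barrier_body: "convex (barrier_body I)"
proof (rule convexI)
  fix x y :: 'a and u v :: real
  assume x: "x \<in> barrier_body I" and y: "y \<in> barrier_body I" and uv: "0 \<le> u" "0 \<le> v" "u + v = 1"
  then have u_eq: "u = 1 - v" by simp
  have "barrier J (u *\<^sub>R x + v *\<^sub>R y) \<le> 1" if J: "J \<subseteq> I" "finite J" for J
  proof -
    have "flat_exp 0 (blinfun_apply (fst p) (u *\<^sub>R x + v *\<^sub>R y) - snd p)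
        \<le> u * flat_exp 0 (blinfun_apply (fst p) x - snd p) + v * flat_exp 0 (blinfun_apply (fst p) y - snd p)" for p
    proof -
      have "blinfun_apply (fst p) (u *\<^sub>R x + v *\<^sub>R y) - snd p
          = u * (blinfun_apply (fst p) x - snd p) + v * (blinfun_apply (fst p) y - snd p)"
        by (simp add: blinfun.bilinear_simps algebra_simps u_eq)
      then show ?thesis
        using convex_onD[OF convex_on_flat_exp, of v "blinfun_apply (fst p) x - snd p"
            "blinfun_apply (fst p) y - snd p"] uv by (simp add: u_eq)
    qed
    then have "barrier J (u *\<^sub>R x + v *\<^sub>R y) \<le> u * barrier J x + v * barrier J y"
      unfolding barrier_def sum_distrib_left sum.distrib[symmetric] by (intro sum_mono)
    also have "\<dots> \<le> u * 1 + v * 1"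
      using x y J uv unfolding barrier_body_def by (intro add_mono mult_left_mono) auto
    finally show ?thesis using uv by simp
  qed
  then show "u *\<^sub>R x + v *\<^sub>R y \<in> barrier_body I" by (simp add: barrier_body_def)
qed

lemma barrier_pos_imp_active:
  assumes "barrier J x > 0"
  shows "\<exists>p\<in>J. blinfun_apply (fst p) x > snd p"
proof (rule ccontr)
  assume "\<not> ?thesis"
  then have "blinfun_apply (fst p) x - snd p \<le> 0" if "p \<in> J" for p
    using that by force
  then have "barrier J x = 0" unfolding barrier_def by simp
  then show False using assms by simp
qed

text \<open>Along a ray the penalty strictly increases as soon as it is positive, and it depends only on
  the values of the functionals; hence these values determine the point of the ray at which
  the penalty equals \<open>1\<close>.\<close>

lemma barrier_strict_antimono_radius:
  assumes J: "finite J" "\<forall>p\<in>J. 0 \<le> snd p" and st: "0 < s" "s < t"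
    and pos: "barrier J (y /\<^sub>R t) > 0"
    and same: "\<And>p. p \<in> J \<Longrightarrow> blinfun_apply (fst p) x = blinfun_apply (fst p) y"
  shows "barrier J (y /\<^sub>R t) < barrier J (x /\<^sub>R s)"
proof -
  let ?f = "\<lambda>p. flat_exp 0 (blinfun_apply (fst p) y / t - snd p)"
  let ?g = "\<lambda>p. flat_exp 0 (blinfun_apply (fst p) y / s - snd p)"
  have less: "?f p < ?g p" if "p \<in> J" "snd p < blinfun_apply (fst p) y / t" for p
  proof (rule flat_exp_0_strict_mono)
    have "0 < blinfun_apply (fst p) y / t" using J that by force
    then have "0 < blinfun_apply (fst p) y" using st by (simp add: zero_less_divide_iff)
    then have "blinfun_apply (fst p) y / t < blinfun_apply (fst p) y / s"
      using st by (intro divide_strict_left_mono) auto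
    then show "blinfun_apply (fst p) y / t - snd p < blinfun_apply (fst p) y / s - snd p"
      "0 < blinfun_apply (fst p) y / s - snd p" using that by auto
  qed
  have le: "?f p \<le> ?g p" if "p \<in> J" for p
  proof (cases "snd p < blinfun_apply (fst p) y / t")
    case False
    then show ?thesis by (simp add: flat_exp_0_nonneg)
  qed (use less[OF that] in simp)
  obtain p where "p \<in> J" "snd p < blinfun_apply (fst p) (y /\<^sub>R t)"
    using barrier_pos_imp_active[OF pos] by blast
  then have "?f p < ?g p"
    by (intro less) (simp_all add: blinfun.bilinear_simps divide_inverse mult.commute)
  then have "\<exists>p\<in>J. ?f p < ?g p" using \<open>p \<in> J\<close> by blast
  then have "sum ?f J < sum ?g J"
    using J le by (intro sum_strict_mono_ex1) auto
  then show ?thesis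
    unfolding barrier_def by (simp add: blinfun.bilinear_simps divide_inverse mult.commute same)
qed

text \<open>The assumptions \<open>inner\<close> and \<open>outer\<close> squeeze the body between two balls, and \<open>locally_finite\<close>
  makes it locally the sublevel set of a finite sum. That last condition is demanded at all
  points satisfying every constraint, a set that contains the body.\<close>

locale barrier_family =
  fixes I :: "(('a::real_normed_vector \<Rightarrow>\<^sub>L real) \<times> real) set" and r R :: real
  assumes r_pos: "r > 0" and R_pos: "R > 0"
    and symmetric: "\<And>p. p \<in> I \<Longrightarrow> (- fst p, snd p) \<in> I"
    and inner: "\<And>p x. p \<in> I \<Longrightarrow> norm x \<le> r \<Longrightarrow> blinfun_apply (fst p) x \<le> snd p"
    and outer: "\<And>x. (\<And>p. p \<in> I \<Longrightarrow> blinfun_apply (fst p) x \<le> snd p + 1) \<Longrightarrow> norm x \<le> R"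
    and locally_finite: "\<And>z. (\<And>p. p \<in> I \<Longrightarrow> blinfun_apply (fst p) z \<le> snd p + 1) \<Longrightarrow>
      \<exists>W. open W \<and> z \<in> W \<and> finite {p \<in> I. \<exists>y\<in>W. blinfun_apply (fst p) y > snd p}"
begin

abbreviation N :: "'a \<Rightarrow> real" where "N \<equiv> minkowski_gauge (barrier_body I)"

lemma threshold_nonneg: "p \<in> I \<Longrightarrow> 0 \<le> snd p"
  using inner[of p 0] r_pos by simp

lemma mem_bodyI:
  assumes "\<And>p. p \<in> I \<Longrightarrow> blinfun_apply (fst p) x \<le> snd p"
  shows "x \<in> barrier_body I"
  using assms by (auto simp: barrier_body_def barrier_def subset_iff intro!: order_trans[OF sum_nonpos])

lemma mem_bodyD:
  assumes "x \<in> barrier_body I" "p \<in> I"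
  shows "blinfun_apply (fst p) x \<le> snd p + 1"
proof -
  have "barrier {p} x \<le> 1" using assms unfolding barrier_body_def by blast
  then have "blinfun_apply (fst p) x - snd p \<le> 1"
    using flat_exp_0_le_1_imp[of "blinfun_apply (fst p) x - snd p"] by (simp add: barrier_def)
  then show ?thesis by simp
qed

lemma cball_subset_body: "cball 0 r \<subseteq> barrier_body I"
  using inner by (auto intro!: mem_bodyI)

lemma gauge_le_iff: "t > 0 \<Longrightarrow> N x \<le> t \<longleftrightarrow> x /\<^sub>R t \<in> barrier_body I"
  using minkowski_gauge_le_iff[OF convex_barrier_body closed_barrier_body r_pos cball_subset_body] .

lemma body_symmetric:
  assumes "x \<in> barrier_body I"
  shows "- x \<in> barrier_body I"
  unfolding barrier_body_def
proof (intro CollectI allI impI)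
  fix J assume J: "J \<subseteq> I" "finite J"
  let ?n = "\<lambda>p :: ('a \<Rightarrow>\<^sub>L real) \<times> real. (- fst p, snd p)"
  have "barrier (?n ` J) x = barrier J (- x)"
    unfolding barrier_def
    by (subst sum.reindex) (auto simp: inj_on_def prod_eq_iff blinfun.bilinear_simps)
  moreover have "?n ` J \<subseteq> I" using J symmetric by auto
  ultimately show "barrier J (- x) \<le> 1"
    using assms J unfolding barrier_body_def by (metis (no_types, lifting) finite_imageI mem_Collect_eq)
qed

lemma equivalent_norm_gauge: "equivalent_norm N"
proof (rule equivalent_norm_minkowski_gauge[OF convex_barrier_body closed_barrier_body body_symmetric
      r_pos cball_subset_body R_pos])
  show "barrier_body I \<subseteq> cball 0 R"
    using outer mem_bodyD by (auto simp: subset_iff)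
qed

lemma functional_le_gauge:
  assumes "p \<in> I"
  shows "blinfun_apply (fst p) x \<le> (snd p + 1) * N x"
proof (cases "x = 0")
  case True
  then show ?thesis
    using equivalent_normD(4)[OF equivalent_norm_gauge, of 0] by simp
next
  case False
  then have pos: "N x > 0" using equivalent_normD(5)[OF equivalent_norm_gauge] by blast
  then have "x /\<^sub>R N x \<in> barrier_body I" using gauge_le_iff by blast
  then have "blinfun_apply (fst p) (x /\<^sub>R N x) \<le> snd p + 1" using assms by (rule mem_bodyD)
  then show ?thesis using pos by (simp add: blinfun.bilinear_simps field_simps)
qed

text \<open>If the active penalties summed to less than \<open>1\<close>, the point could be moved outwards without
  leaving the body, and its gauge would be less than \<open>1\<close>.\<close>

lemma barrier_eq_1_on_unit_sphere:
  assumes W: "open W" "y \<in> W" and J: "finite J" "J \<subseteq> I"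
    and inactive: "\<And>y p. y \<in> W \<Longrightarrow> p \<in> I \<Longrightarrow> p \<notin> J \<Longrightarrow> blinfun_apply (fst p) y \<le> snd p"
    and "N y = 1"
  shows "barrier J y = 1"
proof (rule ccontr)
  assume "barrier J y \<noteq> 1"
  have "y \<in> barrier_body I" using gauge_le_iff[of 1 y] \<open>N y = 1\<close> by simp
  then have "barrier J y \<le> 1" using J unfolding barrier_body_def by blast
  with \<open>barrier J y \<noteq> 1\<close> have lt: "barrier J y < 1" by simp
  have "((\<lambda>s::real. y /\<^sub>R s) \<longlongrightarrow> y /\<^sub>R 1) (at_left 1)"
    by (intro tendsto_intros) auto
  then have lim: "((\<lambda>s::real. y /\<^sub>R s) \<longlongrightarrow> y) (at_left 1)" by simp
  have "open (W \<inter> {x. barrier J x < 1})"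
    using W by (intro open_Int open_Collect_less continuous_on_barrier continuous_on_const)
  then have "\<forall>\<^sub>F s in at_left 1. y /\<^sub>R s \<in> W \<inter> {x. barrier J x < 1}"
    using W lt by (intro topological_tendstoD[OF lim]) auto
  moreover have "\<forall>\<^sub>F s in at_left (1::real). s \<in> {0<..<1}"
    by (rule eventually_at_leftI[of 0]) auto
  ultimately have "\<forall>\<^sub>F s in at_left 1. y /\<^sub>R s \<in> W \<and> barrier J (y /\<^sub>R s) < 1 \<and> 0 < s \<and> s < 1"
    by eventually_elim auto
  then obtain s where s: "y /\<^sub>R s \<in> W" "barrier J (y /\<^sub>R s) < 1" "0 < s" "s < 1"
    using eventually_happens'[OF trivial_limit_at_left_real] by blast
  have "y /\<^sub>R s \<in> barrier_body I"
    unfolding barrier_body_def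
  proof (intro CollectI allI impI)
    fix J' assume J': "J' \<subseteq> I" "finite J'"
    have "\<forall>p\<in>J' - J' \<inter> J. flat_exp 0 (blinfun_apply (fst p) (y /\<^sub>R s) - snd p) = 0"
    proof
      fix p assume "p \<in> J' - J' \<inter> J"
      then have "blinfun_apply (fst p) (y /\<^sub>R s) \<le> snd p" using inactive[OF s(1)] J' by blast
      then show "flat_exp 0 (blinfun_apply (fst p) (y /\<^sub>R s) - snd p) = 0" by simp
    qed
    then have "barrier J' (y /\<^sub>R s) = barrier (J' \<inter> J) (y /\<^sub>R s)"
      unfolding barrier_def using J' by (intro sum.mono_neutral_right) auto
    also have "\<dots> \<le> barrier J (y /\<^sub>R s)"
      unfolding barrier_def using J by (intro sum_mono2) (auto simp: flat_exp_0_nonneg)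
    finally show "barrier J' (y /\<^sub>R s) \<le> 1" using s by simp
  qed
  then have "N y \<le> s" using gauge_le_iff s by blast
  then show False using s \<open>N y = 1\<close> by simp
qed

lemma local_barrier_equation:
  assumes "x \<noteq> 0"
  shows "\<exists>U J. open U \<and> x \<in> U \<and> 0 \<notin> U \<and> finite J \<and> J \<subseteq> I \<and> (\<forall>y\<in>U. barrier J (y /\<^sub>R N y) = 1)"
proof -
  note norm = equivalent_normD[OF equivalent_norm_gauge]
  define w where "w y = y /\<^sub>R N y" for y
  have sphere: "N (w y) = 1" if "y \<noteq> 0" for y
    using norm(5)[OF that] unfolding w_def norm(1) by simp
  then have "w x \<in> barrier_body I"
    using gauge_le_iff[of 1 "w x"] assms by simp
  then obtain W where W: "open W" "w x \<in> W"
    "finite {p \<in> I. \<exists>y\<in>W. blinfun_apply (fst p) y > snd p}"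
    using locally_finite[of "w x"] mem_bodyD by blast
  let ?J = "{p \<in> I. \<exists>y\<in>W. blinfun_apply (fst p) y > snd p}"
  have "open (- {0} \<inter> w -` W)"
    using continuous_on_normalize[OF equivalent_norm_gauge] W
    unfolding w_def by (intro continuous_open_preimage) auto
  moreover have "barrier ?J (w y) = 1" if "y \<in> - {0} \<inter> w -` W" for y
    using that W sphere by (intro barrier_eq_1_on_unit_sphere[of W]) (auto intro: leI)
  ultimately show ?thesis
    using assms W
    by (intro exI[of _ "- {0} \<inter> w -` W"] exI[of _ ?J] conjI) (auto simp: w_def)
qed

lemma LFC_norm_gauge: "LFC_norm N"
  unfolding LFC_norm_def LFC_on_def
proof
  fix x :: 'a assume "x \<in> - {0}"
  then have "x \<noteq> 0" by simp
  obtain U J where U: "open U" "x \<in> U" "0 \<notin> U" and J: "finite J" "J \<subseteq> I"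
    and eq: "\<And>y. y \<in> U \<Longrightarrow> barrier J (y /\<^sub>R N y) = 1"
    using local_barrier_equation[OF \<open>x \<noteq> 0\<close>] by blast
  have nonneg: "\<forall>p\<in>J. 0 \<le> snd p" using J threshold_nonneg by auto
  have "N y = N x" if y: "y \<in> U" and same: "\<forall>\<phi>\<in>fst ` J. blinfun_apply \<phi> y = blinfun_apply \<phi> x" for y
  proof -
    have pos: "N x > 0" "N y > 0"
      using U y equivalent_normD(5)[OF equivalent_norm_gauge] by metis+
    show ?thesis
      using barrier_strict_antimono_radius[OF J(1) nonneg pos(1), of "N y" y x]
        barrier_strict_antimono_radius[OF J(1) nonneg pos(2), of "N x" x y]
        eq[OF y] eq[OF U(2)] same by (cases "N x" "N y" rule: linorder_cases) auto
  qed
  then have "\<forall>y\<in>U. (\<forall>\<phi>\<in>fst ` J. blinfun_apply \<phi> y = blinfun_apply \<phi> x) \<longrightarrow> N y = N x"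
    by blast
  moreover have "U \<subseteq> - {0}" using U by blast
  moreover have "finite (fst ` J)" using J by simp
  ultimately show "LFC_at (- {0}) N x"
    unfolding LFC_at_def using U(1,2) by blast
qed

text \<open>Implicit differentiation of the local equation gives
  \<open>N'(y) = (\<Sum>\<phi>. b \<phi> y \<cdot> \<phi>) / S y\<close>, where \<open>S y\<close> is the derivative of the penalty at \<open>y / N y\<close> in
  the radial direction. It is positive since active functionals are positive there.\<close>

lemma C_infinity_smooth_norm_gauge: "C_infinity_smooth_norm N"
  unfolding C_infinity_smooth_norm_def
proof (rule infinitely_differentiable_on_locally)
  show "open (- {0::'a})" by (rule open_Compl) simp
  fix x :: 'a assume "x \<in> - {0}"
  then have "x \<noteq> 0" by simp
  obtain U J where U: "open U" "x \<in> U" "0 \<notin> U" and J: "finite J" "J \<subseteq> I"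
    and eq: "\<And>y. y \<in> U \<Longrightarrow> barrier J (y /\<^sub>R N y) = 1"
    using local_barrier_equation[OF \<open>x \<noteq> 0\<close>] by blast
  define F where "F = fst ` J"
  have F: "finite F" using J by (simp add: F_def)
  let ?A = "generated_algebra F flat_exp U N"
  \<comment> \<open>Several pairs may share a functional with different thresholds.\<close>
  define b where "b \<phi> y =
    (\<Sum>p\<in>{p \<in> J. fst p = \<phi>}. flat_exp 1 (blinfun_apply \<phi> y * inverse (N y) + (- snd p)))" for \<phi> y
  define S where "S y = (\<Sum>\<phi>\<in>F. b \<phi> y * (blinfun_apply \<phi> y * inverse (N y)))" for y
  have pos: "N y > 0" if "y \<in> U" for y
    using U that equivalent_normD(5)[OF equivalent_norm_gauge] by metis
  have grad: "(\<Sum>p\<in>J. flat_exp 1 (blinfun_apply (fst p) (y /\<^sub>R N y) - snd p) * blinfun_apply (fst p) h)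
      = (\<Sum>\<phi>\<in>F. b \<phi> y * blinfun_apply \<phi> h)" for y h
    unfolding F_def b_def sum_distrib_right
    by (subst sum.image_gen[OF J(1), of _ fst])
      (auto simp: blinfun.bilinear_simps mult.commute intro!: sum.cong)
  have S_eq: "S y = (\<Sum>p\<in>J. flat_exp 1 (blinfun_apply (fst p) (y /\<^sub>R N y) - snd p)
      * blinfun_apply (fst p) (y /\<^sub>R N y))" for y
    unfolding grad S_def by (simp add: blinfun.bilinear_simps mult.commute)
  have S_pos: "S y > 0" if y: "y \<in> U" for y
  proof -
    let ?z = "y /\<^sub>R N y"
    obtain p where p: "p \<in> J" "blinfun_apply (fst p) ?z > snd p"
      using barrier_pos_imp_active[of J ?z] eq[OF y] by auto
    have term_pos: "flat_exp 1 (blinfun_apply (fst q) ?z - snd q) * blinfun_apply (fst q) ?z > 0"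
      if "q \<in> J" "blinfun_apply (fst q) ?z > snd q" for q
    proof -
      have "blinfun_apply (fst q) ?z > 0" using threshold_nonneg[of q] that J by auto
      then show ?thesis using flat_exp_1_pos that by simp
    qed
    have "flat_exp 1 (blinfun_apply (fst q) ?z - snd q) * blinfun_apply (fst q) ?z \<ge> 0"
      if "q \<in> J" for q
      using term_pos[OF that] by (cases "blinfun_apply (fst q) ?z > snd q") auto
    then show ?thesis
      unfolding S_eq using term_pos[OF p] p J(1) by (intro sum_pos2[of J p]) auto
  qed
  have b_in: "b \<phi> \<in> ?A" if "\<phi> \<in> F" for \<phi>
    unfolding b_def using that pos
    by (intro generated_algebra_sum generated_algebra.comp generated_algebra.add generated_algebra.mult
        generated_algebra.functional generated_algebra.inverse generated_algebra.base
        generated_algebra.const) force+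
  have S_in: "S \<in> ?A"
    unfolding S_def using pos
    by (intro generated_algebra_sum generated_algebra.mult b_in generated_algebra.functional
        generated_algebra.inverse generated_algebra.base) force+
  have "infinitely_differentiable_on U N"
  proof (rule infinitely_differentiable_on_if_derivative_in_generated_algebra
      [where \<psi> = flat_exp, OF F flat_exp_has_field_derivative])
    show "(\<lambda>y. b \<phi> y * inverse (S y)) \<in> ?A" if "\<phi> \<in> F" for \<phi>
      using S_pos that by (intro generated_algebra.mult generated_algebra.inverse b_in S_in) force+
    show "(N has_derivative (\<lambda>h. \<Sum>\<phi>\<in>F. b \<phi> y * inverse (S y) * blinfun_apply \<phi> h)) (at y)"
      if y: "y \<in> U" for y
    proof -
      have "(N has_derivative (\<lambda>h. (\<Sum>\<phi>\<in>F. b \<phi> y * blinfun_apply \<phi> h) / S y)) (at y)"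
        unfolding S_eq grad[symmetric]
        by (rule equivalent_norm_has_derivative_if_level_set
            [OF equivalent_norm_gauge U(1) y U(3) eq barrier_has_derivative])
          (use S_pos[OF y] S_eq[of y] in auto)
      then show ?thesis
        by (simp add: divide_inverse sum_distrib_left mult_ac)
    qed
  qed
  then show "\<exists>U. open U \<and> x \<in> U \<and> infinitely_differentiable_on U N"
    using U by blast
qed

end

section \<open>A ball with sharp tips in the space of functions vanishing at infinity\<close>

lift_definition coord_blinfun :: "'g \<Rightarrow> 'g c0 \<Rightarrow>\<^sub>L real" is "\<lambda>\<gamma> x. coord x \<gamma>"
  by (rule bounded_linear_intro[where K = 1]) (simp_all add: coord_le_norm)

lift_definition unit_c0 :: "'g \<Rightarrow> 'g c0" is "\<lambda>\<gamma> \<delta>. if \<delta> = \<gamma> then 1 else 0"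
proof -
  fix \<gamma> :: 'g and \<epsilon> :: real
  assume "\<epsilon> > 0"
  then have "{\<delta>. \<epsilon> < \<bar>if \<delta> = \<gamma> then 1 else 0\<bar>} \<subseteq> {\<gamma>}" by auto
  then show "finite {\<delta>. \<epsilon> < \<bar>if \<delta> = \<gamma> then 1 else (0::real)\<bar>}"
    by (rule finite_subset) simp
qed

lemma coord_unit_c0: "coord (unit_c0 \<gamma>) \<delta> = (if \<delta> = \<gamma> then 1 else 0)"
  by transfer simp

text \<open>The constraint \<open>s x \<gamma> \<le> 1\<close>, multiplied by \<open>k \<gamma>\<close> so that its penalty starts at
  \<open>1 - 1 / k \<gamma>\<close> and reaches \<open>1\<close> at \<open>1\<close>.\<close>

definition peak :: "('g \<Rightarrow> real) \<Rightarrow> 'g \<Rightarrow> real \<Rightarrow> ('g c0 \<Rightarrow>\<^sub>L real) \<times> real" where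
  "peak k \<gamma> s = ((s * k \<gamma>) *\<^sub>R coord_blinfun \<gamma>, k \<gamma> - 1)"

text \<open>The constraint \<open>(1 - 2 / k \<gamma>) s x \<gamma> + t x \<delta> / 2 \<le> 1\<close>, multiplied by \<open>k \<gamma>\<close> in the same
  way.\<close>

definition slope :: "('g \<Rightarrow> real) \<Rightarrow> 'g \<Rightarrow> 'g \<Rightarrow> real \<Rightarrow> real \<Rightarrow> ('g c0 \<Rightarrow>\<^sub>L real) \<times> real" where
  "slope k \<gamma> \<delta> s t = ((s * (k \<gamma> - 2)) *\<^sub>R coord_blinfun \<gamma> + (t * (k \<gamma> / 2)) *\<^sub>R coord_blinfun \<delta>, k \<gamma> - 1)"

definition spikes :: "('g \<Rightarrow> real) \<Rightarrow> (('g c0 \<Rightarrow>\<^sub>L real) \<times> real) set" where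
  "spikes k = {peak k \<gamma> s |\<gamma> s. s \<in> {1, -1}} \<union>
     {slope k \<gamma> \<delta> s t |\<gamma> \<delta> s t. \<delta> \<noteq> \<gamma> \<and> s \<in> {1, -1} \<and> t \<in> {1, -1}}"

lemma peak_in_spikes: "s \<in> {1, -1} \<Longrightarrow> peak k \<gamma> s \<in> spikes k"
  unfolding spikes_def
  by (rule UnI1, rule CollectI, rule exI[of _ \<gamma>], rule exI[of _ s]) simp

lemma slope_in_spikes:
  "\<delta> \<noteq> \<gamma> \<Longrightarrow> s \<in> {1, -1} \<Longrightarrow> t \<in> {1, -1} \<Longrightarrow> slope k \<gamma> \<delta> s t \<in> spikes k"
  unfolding spikes_def
  by (rule UnI2, rule CollectI, rule exI[of _ \<gamma>], rule exI[of _ \<delta>], rule exI[of _ s], rule exI[of _ t]) simp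

lemma peak_apply: "blinfun_apply (fst (peak k \<gamma> s)) x = k \<gamma> * (s * coord x \<gamma>)"
  by (simp add: peak_def blinfun.bilinear_simps coord_blinfun.rep_eq)

lemma slope_apply:
  "blinfun_apply (fst (slope k \<gamma> \<delta> s t)) x = (k \<gamma> - 2) * (s * coord x \<gamma>) + k \<gamma> / 2 * (t * coord x \<delta>)"
  by (simp add: slope_def blinfun.bilinear_simps coord_blinfun.rep_eq)

lemma snd_peak_slope: "snd (peak k \<gamma> s) = k \<gamma> - 1" "snd (slope k \<gamma> \<delta> s t) = k \<gamma> - 1"
  by (simp_all add: peak_def slope_def)

lemma spikes_cases:
  assumes "p \<in> spikes k"
  obtains (peak) \<gamma> s where "p = peak k \<gamma> s" "\<bar>s\<bar> = 1" "s \<in> {1, -1}"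
  | (slope) \<gamma> \<delta> s t where "p = slope k \<gamma> \<delta> s t" "\<delta> \<noteq> \<gamma>" "\<bar>s\<bar> = 1" "\<bar>t\<bar> = 1" "s \<in> {1, -1}" "t \<in> {1, -1}"
  using assms unfolding spikes_def by force

lemma sign_choice: "\<exists>s\<in>{1, -1}. s * x = \<bar>x\<bar>" for x :: real
  by (cases "x \<ge> 0") auto

lemma sign_mult_le_abs: "\<bar>s\<bar> = 1 \<Longrightarrow> s * x \<le> \<bar>x\<bar>" for s x :: real
  by (metis abs_ge_self abs_mult mult_1)

lemma scaled_sign_mult_le_abs: "\<bar>s\<bar> = 1 \<Longrightarrow> 0 \<le> m \<Longrightarrow> m * (s * x) \<le> m * \<bar>x\<bar>" for s m x :: real
  by (rule mult_left_mono[OF sign_mult_le_abs])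

text \<open>Local finiteness. An active constraint of weight \<open>k \<gamma>\<close> forces \<open>\<bar>y \<gamma>\<bar> > 1 / 4\<close>, since the second
  coordinate, if there is one, contributes only a little more than half of what is needed. This leaves finitely
  many \<open>\<gamma>\<close>, whose weights are bounded by \<open>K\<close>, and then the second coordinate must exceed
  \<open>1 / K\<close> for the slope constraint to be active. The radius \<open>1 / (2 K)\<close> transfers both bounds from
  \<open>y\<close> to the centre \<open>z\<close>.\<close>

lemma active_spikes_subset:
  fixes z :: "'g c0"
  assumes k: "\<And>\<gamma>. k \<gamma> \<ge> 8"
    and z: "\<And>\<gamma>. \<bar>coord z \<gamma>\<bar> \<le> 1"
    and K: "K \<ge> 8" "\<And>\<gamma>. \<bar>coord z \<gamma>\<bar> > 1 / 8 \<Longrightarrow> k \<gamma> \<le> K"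
    and y: "dist z y < 1 / (2 * K)"
    and p: "p \<in> spikes k" "blinfun_apply (fst p) y > snd p"
    and T: "T = {\<gamma>. \<bar>coord z \<gamma>\<bar> > 1 / (2 * K)}"
  shows "p \<in> (\<lambda>(\<gamma>, s). peak k \<gamma> s) ` (T \<times> {1, -1}) \<union>
    (\<lambda>(\<gamma>, \<delta>, s, t). slope k \<gamma> \<delta> s t) ` (T \<times> T \<times> {1, -1} \<times> {1, -1})"
proof -
  have K2: "1 / (2 * K) \<le> 1 / 16" using K by (simp add: field_simps)
  have near: "\<bar>coord y \<gamma>\<bar> \<le> \<bar>coord z \<gamma>\<bar> + 1 / (2 * K)" for \<gamma>
    using coord_le_norm[of "z - y" \<gamma>] y unfolding dist_norm by simp
  have mem_T: "\<gamma> \<in> T" if "\<bar>coord y \<gamma>\<bar> > 1 / K" for \<gamma>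
    using near[of \<gamma>] that unfolding T by (simp add: field_simps)
  have large: "\<gamma> \<in> T \<and> \<bar>coord z \<gamma>\<bar> > 1 / 8" if "\<bar>coord y \<gamma>\<bar> > 1 / 4" for \<gamma>
    using near[of \<gamma>] that K2 unfolding T by simp
  from p(1) show ?thesis
  proof (cases rule: spikes_cases)
    case (peak \<gamma> s)
    have "k \<gamma> * (s * coord y \<gamma>) \<le> k \<gamma> * \<bar>coord y \<gamma>\<bar>"
      using k[of \<gamma>] by (intro scaled_sign_mult_le_abs[OF peak(2)]) simp
    then have act: "k \<gamma> - 1 < k \<gamma> * \<bar>coord y \<gamma>\<bar>"
      using p(2) unfolding peak(1) peak_apply snd_peak_slope by linarith
    have "\<bar>coord y \<gamma>\<bar> > 1 / 4"
    proof (rule ccontr)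
      assume "\<not> \<bar>coord y \<gamma>\<bar> > 1 / 4"
      then have "k \<gamma> * \<bar>coord y \<gamma>\<bar> \<le> k \<gamma> * (1 / 4)"
        using k[of \<gamma>] by (intro mult_left_mono) auto
      then show False using act k[of \<gamma>] by linarith
    qed
    then show ?thesis using large peak by auto
  next
    case (slope \<gamma> \<delta> s t)
    have "(k \<gamma> - 2) * (s * coord y \<gamma>) \<le> (k \<gamma> - 2) * \<bar>coord y \<gamma>\<bar>"
      using k[of \<gamma>] by (intro scaled_sign_mult_le_abs[OF slope(3)]) simp
    moreover have "k \<gamma> / 2 * (t * coord y \<delta>) \<le> k \<gamma> / 2 * \<bar>coord y \<delta>\<bar>"
      using k[of \<gamma>] by (intro scaled_sign_mult_le_abs[OF slope(4)]) simp
    ultimately have act: "k \<gamma> - 1 < (k \<gamma> - 2) * \<bar>coord y \<gamma>\<bar> + k \<gamma> / 2 * \<bar>coord y \<delta>\<bar>"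
      using p(2) unfolding slope(1) slope_apply snd_peak_slope by linarith
    have y_le: "\<bar>coord y \<delta>\<bar> \<le> 17 / 16" using near[of \<delta>] z[of \<delta>] K2 by linarith
    then have \<delta>_le: "k \<gamma> / 2 * \<bar>coord y \<delta>\<bar> \<le> k \<gamma> / 2 * (17 / 16)"
      using k[of \<gamma>] by (intro mult_left_mono) auto
    have "\<bar>coord y \<gamma>\<bar> > 1 / 4"
    proof (rule ccontr)
      assume "\<not> \<bar>coord y \<gamma>\<bar> > 1 / 4"
      then have "(k \<gamma> - 2) * \<bar>coord y \<gamma>\<bar> \<le> (k \<gamma> - 2) * (1 / 4)"
        using k[of \<gamma>] by (intro mult_left_mono) auto
      then have "k \<gamma> - 1 < (k \<gamma> - 2) * (1 / 4) + k \<gamma> / 2 * (17 / 16)"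
        by (rule less_le_trans[OF act add_mono[OF _ \<delta>_le]])
      then show False using k[of \<gamma>] by (simp add: field_simps)
    qed
    then have \<gamma>: "\<gamma> \<in> T" and k_le: "k \<gamma> \<le> K" using large K(2) by auto
    have "(k \<gamma> - 2) * \<bar>coord y \<gamma>\<bar> \<le> (k \<gamma> - 2) * (1 + 1 / (2 * K))"
      using near[of \<gamma>] z[of \<gamma>] k[of \<gamma>] by (intro mult_left_mono) auto
    also have "\<dots> = k \<gamma> - 2 + (k \<gamma> - 2) * (1 / (2 * K))" by (simp add: distrib_left)
    also have "(k \<gamma> - 2) * (1 / (2 * K)) \<le> K * (1 / (2 * K))"
      using k_le K by (intro mult_right_mono) auto
    also have "K * (1 / (2 * K)) = 1 / 2" using K by simp
    finally have "k \<gamma> / 2 * \<bar>coord y \<delta>\<bar> > 1 / 2" using act by linarith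
    moreover have "k \<gamma> / 2 * \<bar>coord y \<delta>\<bar> \<le> K / 2 * \<bar>coord y \<delta>\<bar>"
      using k_le by (intro mult_right_mono) auto
    ultimately have "\<bar>coord y \<delta>\<bar> > 1 / K" using K by (simp add: field_simps)
    then have "\<delta> \<in> T" by (rule mem_T)
    then have "(\<gamma>, \<delta>, s, t) \<in> T \<times> T \<times> {1, -1} \<times> {1, -1}" using \<gamma> slope by blast
    then show ?thesis unfolding slope(1) by (intro UnI2 image_eqI[of _ _ "(\<gamma>, \<delta>, s, t)"]) simp_all
  qed
qed

lemma barrier_family_spikes:
  fixes k :: "'g \<Rightarrow> real"
  assumes k: "\<And>\<gamma>. k \<gamma> \<ge> 8"
  shows "barrier_family (spikes k) (1 / 2) 1"
proof
  show "(- fst p, snd p) \<in> spikes k" if "p \<in> spikes k" for p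
    using that
  proof (cases rule: spikes_cases)
    case (peak \<gamma> s)
    then have "(- fst p, snd p) = peak k \<gamma> (- s)" by (simp add: peak_def)
    then show ?thesis using peak(3) by (auto intro: peak_in_spikes)
  next
    case (slope \<gamma> \<delta> s t)
    then have "(- fst p, snd p) = slope k \<gamma> \<delta> (- s) (- t)" by (simp add: slope_def)
    then show ?thesis using slope(2,5,6) by (auto intro: slope_in_spikes)
  qed
  show "blinfun_apply (fst p) x \<le> snd p" if p: "p \<in> spikes k" and x: "norm x \<le> 1 / 2"
    for p and x :: "'g c0"
  proof -
    have small: "m * (s * coord x \<gamma>) \<le> m * (1 / 2)" if "\<bar>s\<bar> = 1" "m \<ge> 0" for m s \<gamma>
      using sign_mult_le_abs[OF that(1), of "coord x \<gamma>"] coord_le_norm[of x \<gamma>] x that(2)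
      by (intro mult_left_mono) linarith+
    from p show ?thesis
    proof (cases rule: spikes_cases)
      case (peak \<gamma> s)
      have "k \<gamma> * (s * coord x \<gamma>) \<le> k \<gamma> * (1 / 2)"
        using k[of \<gamma>] by (intro small[OF peak(2)]) simp
      then show ?thesis
        using k[of \<gamma>] unfolding peak(1) peak_apply snd_peak_slope by linarith
    next
      case (slope \<gamma> \<delta> s t)
      have "(k \<gamma> - 2) * (s * coord x \<gamma>) \<le> (k \<gamma> - 2) * (1 / 2)"
        using k[of \<gamma>] by (intro small[OF slope(3)]) simp
      moreover have "k \<gamma> / 2 * (t * coord x \<delta>) \<le> k \<gamma> / 2 * (1 / 2)"
        using k[of \<gamma>] by (intro small[OF slope(4)]) simp
      ultimately have "(k \<gamma> - 2) * (s * coord x \<gamma>) + k \<gamma> / 2 * (t * coord x \<delta>)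
          \<le> (k \<gamma> - 2) * (1 / 2) + k \<gamma> / 2 * (1 / 2)" by (rule add_mono)
      also have "\<dots> \<le> k \<gamma> - 1" using k[of \<gamma>] by (simp add: field_simps)
      finally show ?thesis unfolding slope(1) slope_apply snd_peak_slope .
    qed
  qed
  have coord_le_1: "\<bar>coord x \<gamma>\<bar> \<le> 1"
    if "\<And>p. p \<in> spikes k \<Longrightarrow> blinfun_apply (fst p) x \<le> snd p + 1" for x :: "'g c0" and \<gamma>
  proof -
    obtain s where s: "s \<in> {1, -1}" "s * coord x \<gamma> = \<bar>coord x \<gamma>\<bar>"
      using sign_choice[of "coord x \<gamma>"] ..
    then have "peak k \<gamma> s \<in> spikes k" by (intro peak_in_spikes)
    from that[OF this] have "k \<gamma> * \<bar>coord x \<gamma>\<bar> \<le> k \<gamma> * 1"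
      unfolding peak_apply snd_peak_slope s(2) by simp
    then show ?thesis using k[of \<gamma>] by simp
  qed
  show "norm x \<le> 1"
    if "\<And>p. p \<in> spikes k \<Longrightarrow> blinfun_apply (fst p) x \<le> snd p + 1" for x :: "'g c0"
    by (intro norm_c0_least coord_le_1 that)
  show "\<exists>W. open W \<and> z \<in> W \<and> finite {p \<in> spikes k. \<exists>y\<in>W. blinfun_apply (fst p) y > snd p}"
    if z: "\<And>p. p \<in> spikes k \<Longrightarrow> blinfun_apply (fst p) z \<le> snd p + 1" for z :: "'g c0"
  proof -
    have coord_z: "\<bar>coord z \<gamma>\<bar> \<le> 1" for \<gamma> by (intro coord_le_1 z)
    define F where "F = {\<gamma>. \<bar>coord z \<gamma>\<bar> > 1 / 8}"
    \<comment> \<open>The sum bounds each weight on the finite set \<open>F\<close>.\<close>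
    define K where "K = 8 + sum k F"
    have "finite F" unfolding F_def by (rule finite_coord) simp
    have k_nonneg: "0 \<le> k \<gamma>" for \<gamma> using k[of \<gamma>] by simp
    have K: "K \<ge> 8" unfolding K_def using k_nonneg by (simp add: sum_nonneg)
    have K_ge: "k \<gamma> \<le> K" if "\<bar>coord z \<gamma>\<bar> > 1 / 8" for \<gamma>
      using member_le_sum[of \<gamma> F k] that k_nonneg \<open>finite F\<close> by (simp add: K_def F_def)
    define T where "T = {\<gamma>. \<bar>coord z \<gamma>\<bar> > 1 / (2 * K)}"
    have "finite T" unfolding T_def using K by (intro finite_coord) simp
    then have "finite ((\<lambda>(\<gamma>, s). peak k \<gamma> s) ` (T \<times> {1, -1}) \<union>
        (\<lambda>(\<gamma>, \<delta>, s, t). slope k \<gamma> \<delta> s t) ` (T \<times> T \<times> {1, -1} \<times> {1, -1}))"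
      by (intro finite_UnI finite_imageI finite_cartesian_product) auto
    moreover have "{p \<in> spikes k. \<exists>y\<in>ball z (1 / (2 * K)). blinfun_apply (fst p) y > snd p} \<subseteq>
        (\<lambda>(\<gamma>, s). peak k \<gamma> s) ` (T \<times> {1, -1}) \<union>
        (\<lambda>(\<gamma>, \<delta>, s, t). slope k \<gamma> \<delta> s t) ` (T \<times> T \<times> {1, -1} \<times> {1, -1})"
    proof
      fix p assume "p \<in> {p \<in> spikes k. \<exists>y\<in>ball z (1 / (2 * K)). blinfun_apply (fst p) y > snd p}"
      then obtain y where "p \<in> spikes k" "dist z y < 1 / (2 * K)" "blinfun_apply (fst p) y > snd p"
        by auto
      then show "p \<in> (\<lambda>(\<gamma>, s). peak k \<gamma> s) ` (T \<times> {1, -1}) \<union>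
          (\<lambda>(\<gamma>, \<delta>, s, t). slope k \<gamma> \<delta> s t) ` (T \<times> T \<times> {1, -1} \<times> {1, -1})"
        using active_spikes_subset[where k = k, OF k coord_z K K_ge _ _ _ T_def] by blast
    qed
    ultimately have "finite {p \<in> spikes k. \<exists>y\<in>ball z (1 / (2 * K)). blinfun_apply (fst p) y > snd p}"
      by (rule finite_subset[rotated])
    then show ?thesis
      using K by (intro exI[of _ "ball z (1 / (2 * K))"]) simp
  qed
qed simp_all

locale spiky_norm =
  fixes k :: "'g \<Rightarrow> real"
  assumes k_ge: "k \<gamma> \<ge> 8"
begin

sublocale barrier_family "spikes k" "1 / 2" 1
  using k_ge by (rule barrier_family_spikes)

lemma abs_coord_le_gauge: "\<bar>coord x \<gamma>\<bar> \<le> N x"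
proof -
  obtain s where s: "s \<in> {1, -1}" "s * coord x \<gamma> = \<bar>coord x \<gamma>\<bar>"
    using sign_choice[of "coord x \<gamma>"] ..
  then have "peak k \<gamma> s \<in> spikes k" by (intro peak_in_spikes)
  then have "k \<gamma> * \<bar>coord x \<gamma>\<bar> \<le> k \<gamma> * N x"
    using functional_le_gauge[of "peak k \<gamma> s" x] s by (simp add: peak_apply snd_peak_slope)
  then show ?thesis using k_ge[of \<gamma>] by simp
qed

lemma cone_le_gauge:
  assumes "\<delta> \<noteq> \<gamma>"
  shows "(1 - 2 / k \<gamma>) * \<bar>coord x \<gamma>\<bar> + \<bar>coord x \<delta>\<bar> / 2 \<le> N x"
proof -
  obtain s where s: "s \<in> {1, -1}" "s * coord x \<gamma> = \<bar>coord x \<gamma>\<bar>"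
    using sign_choice[of "coord x \<gamma>"] ..
  obtain t where t: "t \<in> {1, -1}" "t * coord x \<delta> = \<bar>coord x \<delta>\<bar>"
    using sign_choice[of "coord x \<delta>"] ..
  from s t have "slope k \<gamma> \<delta> s t \<in> spikes k" using assms by (intro slope_in_spikes)
  then have "(k \<gamma> - 2) * \<bar>coord x \<gamma>\<bar> + k \<gamma> / 2 * \<bar>coord x \<delta>\<bar> \<le> k \<gamma> * N x"
    using functional_le_gauge[of "slope k \<gamma> \<delta> s t" x] s t by (simp add: slope_apply snd_peak_slope)
  then show ?thesis using k_ge[of \<gamma>] by (simp add: field_simps)
qed

text \<open>Just below the tip no constraint is active.\<close>

lemma gauge_peak_le_1: "N ((1 - 1 / k \<gamma>) *\<^sub>R unit_c0 \<gamma>) \<le> 1"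
proof -
  let ?x = "(1 - 1 / k \<gamma>) *\<^sub>R unit_c0 \<gamma>"
  have k_pos: "k \<gamma> > 0" "1 - 1 / k \<gamma> \<ge> 0" "1 - 1 / k \<gamma> \<le> 1"
    using k_ge[of \<gamma>] by (auto simp: field_simps)
  have bound: "s * coord ?x \<delta> \<le> (if \<delta> = \<gamma> then 1 - 1 / k \<gamma> else 0)" if "\<bar>s\<bar> = 1" for s \<delta>
    using sign_mult_le_abs[OF that, of "1 - 1 / k \<gamma>"] abs_of_nonneg[OF k_pos(2)]
    by (auto simp: coord_unit_c0)
  have bound_1: "s * coord ?x \<delta> \<le> (if \<delta> = \<gamma> then 1 else 0)" if "\<bar>s\<bar> = 1" for s \<delta>
    by (rule order_trans[OF bound[OF that]]) (use k_pos(3) in auto)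
  have "?x \<in> barrier_body (spikes k)"
  proof (rule mem_bodyI)
    fix p assume "p \<in> spikes k"
    then show "blinfun_apply (fst p) ?x \<le> snd p"
    proof (cases rule: spikes_cases)
      case (peak \<alpha> s)
      have "k \<alpha> * (s * coord ?x \<alpha>) \<le> k \<alpha> * (if \<alpha> = \<gamma> then 1 - 1 / k \<gamma> else 0)"
        using bound[OF peak(2)] k_ge[of \<alpha>] by (intro mult_left_mono) auto
      also have "\<dots> \<le> k \<alpha> - 1" using k_pos k_ge[of \<alpha>] by (auto simp: field_simps)
      finally show ?thesis unfolding peak(1) peak_apply snd_peak_slope .
    next
      case (slope \<alpha> \<delta> s t)
      have "(k \<alpha> - 2) * (s * coord ?x \<alpha>) \<le> (k \<alpha> - 2) * (if \<alpha> = \<gamma> then 1 else 0)"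
        using k_ge[of \<alpha>] by (intro mult_left_mono bound_1[OF slope(3)]) simp
      moreover have "k \<alpha> / 2 * (t * coord ?x \<delta>) \<le> k \<alpha> / 2 * (if \<delta> = \<gamma> then 1 else 0)"
        using k_ge[of \<alpha>] by (intro mult_left_mono bound_1[OF slope(4)]) simp
      ultimately have "(k \<alpha> - 2) * (s * coord ?x \<alpha>) + k \<alpha> / 2 * (t * coord ?x \<delta>)
          \<le> (k \<alpha> - 2) * (if \<alpha> = \<gamma> then 1 else 0) + k \<alpha> / 2 * (if \<delta> = \<gamma> then 1 else 0)"
        by (rule add_mono)
      also have "\<dots> \<le> k \<alpha> - 1" using k_ge[of \<alpha>] slope(2) by auto
      finally show ?thesis unfolding slope(1) slope_apply snd_peak_slope .
    qed
  qed
  then show ?thesis using gauge_le_iff[of 1 ?x] by simp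
qed

text \<open>In the slice the main coordinate varies by at most \<open>2 / k \<gamma>\<close>, and the slope constraints leave
  at most \<open>8 / k \<gamma>\<close> for the absolute value of each other coordinate.\<close>

lemma slice_diameter:
  assumes x: "N x \<le> 1" "coord x \<gamma> > 1 - 2 / k \<gamma>" and y: "N y \<le> 1" "coord y \<gamma> > 1 - 2 / k \<gamma>"
  shows "norm (x - y) \<le> 16 / k \<gamma>"
proof (rule norm_c0_least)
  have k: "k \<gamma> > 0" "2 / k \<gamma> \<le> 1" using k_ge[of \<gamma>] by auto
  have off: "\<bar>coord z \<delta>\<bar> \<le> 8 / k \<gamma>" if z: "N z \<le> 1" "coord z \<gamma> > 1 - 2 / k \<gamma>" and "\<delta> \<noteq> \<gamma>" for z \<delta>
  proof -
    have "(1 - 2 / k \<gamma>) * (1 - 2 / k \<gamma>) \<le> (1 - 2 / k \<gamma>) * \<bar>coord z \<gamma>\<bar>"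
      using z k by (intro mult_left_mono) auto
    then have "(1 - 2 / k \<gamma>) * (1 - 2 / k \<gamma>) + \<bar>coord z \<delta>\<bar> / 2 \<le> 1"
      using cone_le_gauge[OF that(3), of z] z by linarith
    moreover have "(1 - 2 / k \<gamma>) * (1 - 2 / k \<gamma>) = 1 - 4 / k \<gamma> + (2 / k \<gamma>) * (2 / k \<gamma>)"
      by (simp add: algebra_simps)
    moreover have "0 \<le> (2 / k \<gamma>) * (2 / k \<gamma>)" by simp
    ultimately show ?thesis by linarith
  qed
  show "\<bar>coord (x - y) \<delta>\<bar> \<le> 16 / k \<gamma>" for \<delta>
  proof (cases "\<delta> = \<gamma>")
    case True
    have "\<bar>coord x \<gamma> - coord y \<gamma>\<bar> \<le> 2 / k \<gamma>"
      using abs_coord_le_gauge[of x \<gamma>] abs_coord_le_gauge[of y \<gamma>] x y by linarith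
    also have "\<dots> \<le> 16 / k \<gamma>" using k by (simp add: divide_right_mono)
    finally show ?thesis using True by simp
  next
    case False
    then show ?thesis using off[OF x False] off[OF y False] by (simp add: abs_le_iff)
  qed
qed

lemma convex_gauge_ball: "convex {x. N x \<le> 1}"
  using gauge_le_iff[of 1] convex_barrier_body[of "spikes k"] by simp

lemma dentable_gauge_ball:
  assumes unbounded: "\<And>B. \<exists>\<gamma>. k \<gamma> > B"
  shows "dentable {x. N x \<le> 1}"
  unfolding dentable_def
proof (intro conjI exI[of _ norm] allI impI convex_gauge_ball)
  show "equivalent_norm (norm :: 'g c0 \<Rightarrow> real)"
    unfolding equivalent_norm_def is_norm_def
    by (auto intro!: exI[of _ "1::real"] norm_triangle_ineq)
  fix \<epsilon> :: real assume "\<epsilon> > 0"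
  obtain \<gamma> where \<gamma>: "k \<gamma> > 16 / \<epsilon>" using unbounded by blast
  have k: "k \<gamma> > 0" "2 / k \<gamma> < 1" using k_ge[of \<gamma>] by auto
  have diam: "16 / k \<gamma> \<le> \<epsilon>" using \<gamma> \<open>\<epsilon> > 0\<close> k by (simp add: field_simps)
  let ?S = "slice {x. N x \<le> 1} (coord_blinfun \<gamma>) (1 - 2 / k \<gamma>)"
  have mem: "x \<in> ?S \<longleftrightarrow> N x \<le> 1 \<and> coord x \<gamma> > 1 - 2 / k \<gamma>" for x
    by (simp add: slice_def coord_blinfun.rep_eq)
  have "(1 - 1 / k \<gamma>) *\<^sub>R unit_c0 \<gamma> \<in> ?S"
    unfolding mem using gauge_peak_le_1[of \<gamma>] k by (simp add: coord_unit_c0 divide_strict_right_mono)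
  then have "?S \<noteq> {}" by blast
  moreover have "norm (x - y) \<le> \<epsilon>" if "x \<in> ?S" "y \<in> ?S" for x y
    using slice_diameter[of x \<gamma> y] that diam unfolding mem by linarith
  ultimately show "\<exists>f a. a > 0 \<and> slice {x. N x \<le> 1} f a \<noteq> {} \<and>
      (\<forall>x\<in>slice {x. N x \<le> 1} f a. \<forall>y\<in>slice {x. N x \<le> 1} f a. norm (x - y) \<le> \<epsilon>)"
    using k by (intro exI[of _ "coord_blinfun \<gamma>"] exI[of _ "1 - 2 / k \<gamma>"]) auto
qed

text \<open>The slope constraint for \<open>(\<gamma>, \<delta>)\<close> adds \<open>t \<bar>h \<delta>\<bar> / 2\<close> to the lower bounds for \<open>N\<close> on both sides
  of the tip, while the contributions of \<open>h \<gamma>\<close> cancel or help; the error comes from \<open>N (unit_c0 \<gamma>) \<le> 1 + 2 / k \<gamma>\<close> and from the factor \<open>1 - 2 / k \<gamma>\<close>.\<close>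

lemma second_difference_lower_bound:
  assumes "\<delta> \<noteq> \<gamma>" "s > 0" "t > 0"
  shows "\<bar>coord h \<delta>\<bar> - 8 * s / (k \<gamma> * t) \<le> second_difference N (s *\<^sub>R unit_c0 \<gamma>) h t"
proof -
  note norm = equivalent_normD[OF equivalent_norm_gauge]
  let ?x = "s *\<^sub>R unit_c0 \<gamma>"
  let ?c = "1 - 2 / k \<gamma>"
  have k: "k \<gamma> \<ge> 8" by (rule k_ge)
  then have c: "?c \<ge> 0" by simp
  have "(1 - 1 / k \<gamma>) * N (unit_c0 \<gamma>) \<le> 1"
    using gauge_peak_le_1[of \<gamma>] k by (simp add: norm(1) abs_if)
  then have "(k \<gamma> - 1) * N (unit_c0 \<gamma>) \<le> k \<gamma>"
    using k by (simp add: field_simps)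
  then have "N (unit_c0 \<gamma>) \<le> k \<gamma> / (k \<gamma> - 1)"
    using k by (simp add: field_simps)
  also have "\<dots> \<le> 1 + 2 / k \<gamma>" using k by (simp add: field_simps)
  finally have "s * N (unit_c0 \<gamma>) \<le> s * (1 + 2 / k \<gamma>)" using assms by (intro mult_left_mono) auto
  then have tip: "N ?x \<le> s * (1 + 2 / k \<gamma>)" using assms by (simp add: norm(1))
  have plus: "?c * \<bar>s + t * coord h \<gamma>\<bar> + t * \<bar>coord h \<delta>\<bar> / 2 \<le> N (?x + t *\<^sub>R h)"
    using cone_le_gauge[OF assms(1), of "?x + t *\<^sub>R h"] assms by (simp add: coord_unit_c0 abs_mult)
  have minus: "?c * \<bar>s - t * coord h \<gamma>\<bar> + t * \<bar>coord h \<delta>\<bar> / 2 \<le> N (?x - t *\<^sub>R h)"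
    using cone_le_gauge[OF assms(1), of "?x - t *\<^sub>R h"] assms by (simp add: coord_unit_c0 abs_mult)
  define q where "q = s / k \<gamma>"
  have "?c * (2 * s) \<le> ?c * (\<bar>s + t * coord h \<gamma>\<bar> + \<bar>s - t * coord h \<gamma>\<bar>)"
    using c by (intro mult_left_mono) auto
  then have "?c * (2 * s) + t * \<bar>coord h \<delta>\<bar> \<le> N (?x + t *\<^sub>R h) + N (?x - t *\<^sub>R h)"
    using plus minus unfolding distrib_left by linarith
  moreover have "?c * (2 * s) = 2 * s - 4 * q" "s * (1 + 2 / k \<gamma>) = s + 2 * q" "8 * s / k \<gamma> = 8 * q"
    by (simp_all add: q_def algebra_simps)
  ultimately have "t * \<bar>coord h \<delta>\<bar> - 8 * s / k \<gamma> \<le> N (?x + t *\<^sub>R h) + N (?x - t *\<^sub>R h) - 2 * N ?x"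
    using tip by linarith
  then have "(t * \<bar>coord h \<delta>\<bar> - 8 * s / k \<gamma>) / t \<le> second_difference N ?x h t"
    unfolding second_difference_def using assms by (intro divide_right_mono) auto
  then show ?thesis using assms by (simp add: diff_divide_distrib)
qed

lemma not_uniformly_Gateaux_gauge:
  assumes unbounded: "\<And>B. \<exists>\<gamma>. k \<gamma> > B" and "h \<noteq> 0"
  shows "\<not> uniformly_Gateaux_in_direction N h"
proof
  assume "uniformly_Gateaux_in_direction N h"
  then obtain M where M: "equivalent_norm M"
    and unif: "uniform_limit {x. M x = 1} (\<lambda>t x. second_difference N x h t) (\<lambda>_. 0) (at 0)"
    unfolding uniformly_Gateaux_in_direction_def by blast
  obtain \<delta> where \<delta>: "coord h \<delta> \<noteq> 0" using \<open>h \<noteq> 0\<close> c0_eqI[of h 0] by auto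
  define \<eta> where "\<eta> = \<bar>coord h \<delta>\<bar>"
  have "\<eta> > 0" using \<delta> by (simp add: \<eta>_def)
  obtain a where a: "a > 0" "\<And>x. a * norm x \<le> M x"
    using M unfolding equivalent_norm_def by blast
  have "\<forall>\<^sub>F t in at 0. \<forall>x\<in>{x. M x = 1}. dist (second_difference N x h t) 0 < \<eta> / 2"
    using unif[unfolded uniform_limit_iff] half_gt_zero[OF \<open>\<eta> > 0\<close>] by blast
  then obtain d where "d > 0" and d: "\<forall>t\<in>UNIV. t \<noteq> 0 \<and> dist t 0 < d \<longrightarrow>
      (\<forall>x\<in>{x. M x = 1}. dist (second_difference N x h t) 0 < \<eta> / 2)"
    unfolding eventually_at by blast
  define t where "t = d / 2"
  have t: "t > 0" "t < d" using \<open>d > 0\<close> by (auto simp: t_def)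
  \<comment> \<open>The bound \<open>k \<delta>\<close> guarantees \<open>\<gamma> \<noteq> \<delta>\<close>; the other one makes the error at most \<open>\<eta> / 2\<close>.\<close>
  obtain \<gamma> where \<gamma>: "k \<gamma> > max (k \<delta>) (16 / (a * t * \<eta>))" using unbounded by blast
  then have "\<delta> \<noteq> \<gamma>" by auto
  let ?e = "unit_c0 \<gamma>"
  have "norm ?e \<ge> 1" using coord_le_norm[of ?e \<gamma>] by (simp add: coord_unit_c0)
  then have "a \<le> a * norm ?e" using a by simp
  then have Me: "a \<le> M ?e" using a(2)[of ?e] by linarith
  define s where "s = 1 / M ?e"
  have s: "s > 0" "s \<le> 1 / a" using Me a by (auto simp: s_def field_simps)
  have "M (s *\<^sub>R ?e) = 1" using equivalent_normD(1)[OF M] Me a by (simp add: s_def)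
  then have "\<bar>second_difference N (s *\<^sub>R ?e) h t\<bar> < \<eta> / 2" using d t by simp
  then have "\<eta> - 8 * s / (k \<gamma> * t) < \<eta> / 2"
    using second_difference_lower_bound[OF \<open>\<delta> \<noteq> \<gamma>\<close> s(1) t(1), of h] by (simp add: \<eta>_def)
  moreover have "8 * s / (k \<gamma> * t) \<le> \<eta> / 2"
  proof -
    have k: "k \<gamma> > 0" using k_ge[of \<gamma>] by simp
    have "16 / (a * t * \<eta>) < k \<gamma>" using \<gamma> by simp
    then have "16 \<le> k \<gamma> * (a * t * \<eta>)"
      using a t \<open>\<eta> > 0\<close> by (simp add: divide_less_eq)
    then have "8 / a \<le> \<eta> / 2 * (k \<gamma> * t)" using a by (simp add: field_simps)
    moreover have "8 * s \<le> 8 / a" using s by simp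
    ultimately have "8 * s \<le> \<eta> / 2 * (k \<gamma> * t)" by linarith
    then show ?thesis using k t by (simp add: pos_divide_le_eq)
  qed
  ultimately show False by simp
qed

end

lemma ex_unbounded_weight:
  assumes "infinite (UNIV :: 'g set)"
  obtains k :: "'g \<Rightarrow> real" where "\<And>\<gamma>. k \<gamma> \<ge> 8" "\<And>B. \<exists>\<gamma>. k \<gamma> > B"
proof -
  obtain f :: "nat \<Rightarrow> 'g" where f: "inj f"
    using assms infinite_countable_subset by blast
  have "\<exists>\<gamma>. 8 + real (inv f \<gamma>) > B" for B
  proof -
    obtain n where "real n > B" using reals_Archimedean2 by blast
    then show ?thesis using inv_f_f[OF f, of n] by (intro exI[of _ "f n"]) simp
  qed
  then show thesis by (intro that[of "\<lambda>\<gamma>. 8 + real (inv f \<gamma>)"]) auto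
qed

theorem theorem2:
  assumes "infinite (UNIV :: 'g set)"
  shows "\<exists>N :: 'g c0 \<Rightarrow> real.
           equivalent_norm N \<and>
           C_infinity_smooth_norm N \<and>
           LFC_norm N \<and>
           dentable {x. N x \<le> 1} \<and>
           (\<forall>h. h \<noteq> 0 \<longrightarrow> \<not> uniformly_Gateaux_in_direction N h)"
proof -
  obtain k :: "'g \<Rightarrow> real" where k: "\<And>\<gamma>. k \<gamma> \<ge> 8" and unbounded: "\<And>B. \<exists>\<gamma>. k \<gamma> > B"
    using ex_unbounded_weight[OF assms] by blast
  interpret spiky_norm k by standard (rule k)
  show ?thesis
    using equivalent_norm_gauge C_infinity_smooth_norm_gauge LFC_norm_gauge
      dentable_gauge_ball[OF unbounded] not_uniformly_Gateaux_gauge[OF unbounded]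
    by blast
qed

end
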